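(* Consider the standard model of floating point arithmetic satisfying the IEEE 754 standard, with set of floating point numbers $\mathbb{F}$. Let $n=mp$ for $n,m,p\in\mathbb{N}$, and let $$A=PTP^T,\qquad U_1=P[\,I,0,\dots,0\,]^T,$$ where $P\in\mathbb{F}^{n\times n}$ is a signed block permutation matrix with blocks of size $p$, $I,0\in\mathbb{F}^{p\times p}$ are the identity and zero matrices, and $T\in\mathbb{F}^{n\times n}$ is a block tridiagonal matrix of the form $$T=\begin{bmatrix}\widetilde M_1 & \widetilde B_2^T\\ \widetilde B_2 & \ddots & \ddots\\ & \ddots & \ddots & \widetilde B_m^T\\ & & \widetilde B_m & \widetilde M_m\end{bmatrix},$$ where $\widetilde M_i\in\mathbb{F}^{p\times p}$ are symmetric and $\widetilde B_{i+1}\in\mathbb{F}^{p\times p}$ are upper triangular with positive entries on the diagonal. Assume that the QR factorization in the block Lanczos algorithm is computed using the classical or modified Gram-Schmidt algorithm without any underflow or overflow. Then the block Lanczos algorithm applied to $A$ and $U_1$ in floating point arithmetic computes exactly. As a consequence, $T_m=T$, where $T_m$ is the block tridiagonal matrix of the computed coefficient blocks.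
   Context: **Floating point arithmetic.** $\mathbb{F}$ is the set of floating point numbers of an IEEE 754 binary format (e.g. binary64, binary32, binary16), with rounding to nearest. For $\alpha,\beta\in\mathbb{F}$ and a basic operation $\circ$ (addition, subtraction, multiplication, division; similarly the square root), $\mathrm{fl}(\alpha\circ\beta)$ is the floating point number nearest to the exact value; if the exact value is within the exponent range (no overflow or underflow), then $\mathrm{fl}(\alpha\circ\beta)=(\alpha\circ\beta)(1+\delta)$ with $|\delta|\le\mathbf{u}$, where $\mathbf{u}$ is the unit roundoff. Inner products and matrix products are evaluated as floating point sums of floating point products; the Euclidean norm is evaluated as the floating point square root of the floating point sum of the floating point squares of the entries. Signed zeros are identified. **Signed block permutation matrix.** A square block matrix with exactly one nonzero block in each block row and block column, where the nonzero blocks are signed permutation matrices (permutation matrices in which the entries $1$ are replaced by $\pm1$). **Block Lanczos algorithm** (input: symmetric $A\in\mathbb{R}^{n\times n}$, $U_1\in\mathbb{R}^{n\times p}$ with $U_1^TU_1=I$). Set $U_0=U_1$, $B_1=0$, $M_1=U_1^TAU_1$. For $i=1,\dots,m-1$: $R_{i+1}=AU_i-U_iM_i-U_{i-1}B_i^T$; $R_{i+1}=U_{i+1}B_{i+1}$ (QR factorization of $R_{i+1}$, with $U_{i+1}\in\mathbb{R}^{n\times p}$ having orthonormal columns and $B_{i+1}\in\mathbb{R}^{p\times p}$ upper triangular with positive diagonal, the diagonal entries being the Euclidean norms computed in the Gram-Schmidt process applied to the columns of $R_{i+1}$); $M_{i+1}=U_{i+1}^TAU_{i+1}$. $T_k$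 is the block tridiagonal matrix with diagonal blocks $M_1,\dots,M_k$, subdiagonal blocks $B_2,\dots,B_k$ and superdiagonal blocks $B_2^T,\dots,B_k^T$. **Computes exactly.** Every block assigned in the lines of the algorithm ($M_i$, $R_i$, $U_i$, $B_i$), when computed in floating point arithmetic, coincides with the corresponding quantity produced by the algorithm in exact arithmetic. *)

theory Defs
  imports
    Complex_Main
    "HOL-Library.Multiset"
    "HOL-Combinatorics.Permutations"
    "Jordan_Normal_Form.Matrix"
begin

section \<open>IEEE 754 binary floating point\<close>

text \<open>A format is given by its precision \<open>t\<close> (number of significand bits) and its
  maximal exponent \<open>emax\<close>; IEEE 754 prescribes the minimal exponent \<open>1 - emax\<close>.  For example,
  binary16, binary32 and binary64 are \<open>(11, 15)\<close>, \<open>(24, 127)\<close> and \<open>(53, 1023)\<close>.\<close>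

definition ieee_format :: "nat \<Rightarrow> int \<Rightarrow> bool" where
  "ieee_format t emax \<longleftrightarrow> 2 \<le> t \<and> 1 \<le> emax"

text \<open>The finite floating point numbers, subnormal numbers included, as real numbers; the two
  signed zeros are thereby identified.\<close>

definition floats :: "nat \<Rightarrow> int \<Rightarrow> real set" where
  "floats t emax = {of_int k * 2 powi (e - int t + 1) | k e :: int.
     \<bar>k\<bar> < 2 ^ t \<and> 1 - emax \<le> e \<and> e \<le> emax}"

text \<open>The largest finite number is \<open>2\<^bsup>emax\<^esup>(2 - 2\<^bsup>1-t\<^esup>)\<close>.  Rounding to nearest overflows from half
  a unit in the last place above it.\<close>

definition overflows :: "nat \<Rightarrow> int \<Rightarrow> real \<Rightarrow> bool" where
  "overflows t emax x \<longleftrightarrow> \<bar>x\<bar> \<ge> 2 powi emax * (2 - 2 powi (- int t))"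

text \<open>IEEE 754 signals underflow (under its default handling) when a nonzero exact result lies
  below the smallest normal number and its delivered value is inexact.  In particular, an exact
  subnormal result is not an underflow.\<close>

definition underflows :: "nat \<Rightarrow> int \<Rightarrow> real \<Rightarrow> bool" where
  "underflows t emax x \<longleftrightarrow> 0 < \<bar>x\<bar> \<and> \<bar>x\<bar> < 2 powi (1 - emax) \<and> x \<notin> floats t emax"

text \<open>Rounding to nearest with an arbitrary rule for ties.  Where IEEE arithmetic would deliver an
  infinity, the value of \<open>fl\<close> is left unspecified.\<close>

definition rounds_to_nearest :: "nat \<Rightarrow> int \<Rightarrow> (real \<Rightarrow> real) \<Rightarrow> bool" where
  "rounds_to_nearest t emax fl \<longleftrightarrow>
     (\<forall>x. \<not> overflows t emax x \<longrightarrow>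
        fl x \<in> floats t emax \<and> (\<forall>y \<in> floats t emax. \<bar>x - fl x\<bar> \<le> \<bar>x - y\<bar>))"

section \<open>Floating point linear algebra\<close>

text \<open>Computations are described relative to a relation \<open>rd\<close>, where \<open>rd x z\<close> means that a basic
  operation with exact value \<open>x\<close> delivers \<open>z\<close>.  The two instances below are plain floating point
  arithmetic, and floating point arithmetic in which no operation overflows or underflows.\<close>

definition fl_op :: "(real \<Rightarrow> real) \<Rightarrow> real \<Rightarrow> real \<Rightarrow> bool" where
  "fl_op fl x z \<longleftrightarrow> z = fl x"

definition fl_op_in_range :: "nat \<Rightarrow> int \<Rightarrow> (real \<Rightarrow> real) \<Rightarrow> real \<Rightarrow> real \<Rightarrow> bool" where
  "fl_op_in_range t emax fl x z \<longleftrightarrow>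
     z = fl x \<and> \<not> overflows t emax x \<and> \<not> underflows t emax x"

text \<open>\<open>fl_sum rd X s\<close>: the sum of the multiset \<open>X\<close> of numbers evaluates to \<open>s\<close> for some order and
  parenthesization of the additions (an accumulator initialized with zero is possible).\<close>

inductive fl_sum :: "(real \<Rightarrow> real \<Rightarrow> bool) \<Rightarrow> real multiset \<Rightarrow> real \<Rightarrow> bool"
  for rd :: "real \<Rightarrow> real \<Rightarrow> bool"
  where
    empty: "fl_sum rd {#} 0"
  | single: "fl_sum rd {#x#} x"
  | add: "fl_sum rd X x \<Longrightarrow> fl_sum rd Y y \<Longrightarrow> rd (x + y) z \<Longrightarrow> fl_sum rd (X + Y) z"

definition fl_inner :: "(real \<Rightarrow> real \<Rightarrow> bool) \<Rightarrow> real vec \<Rightarrow> real vec \<Rightarrow> real \<Rightarrow> bool" where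
  "fl_inner rd v w z \<longleftrightarrow> dim_vec v = dim_vec w \<and>
     (\<exists>y :: nat \<Rightarrow> real. (\<forall>k < dim_vec v. rd (v $ k * w $ k) (y k)) \<and>
        fl_sum rd (image_mset y (mset_set {..<dim_vec v})) z)"

definition fl_norm :: "(real \<Rightarrow> real \<Rightarrow> bool) \<Rightarrow> real vec \<Rightarrow> real \<Rightarrow> bool" where
  "fl_norm rd v z \<longleftrightarrow> (\<exists>y. fl_inner rd v v y \<and> rd (sqrt y) z)"

definition fl_mult :: "(real \<Rightarrow> real \<Rightarrow> bool) \<Rightarrow> real mat \<Rightarrow> real mat \<Rightarrow> real mat \<Rightarrow> bool" where
  "fl_mult rd X Y Z \<longleftrightarrow> Z \<in> carrier_mat (dim_row X) (dim_col Y) \<and>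
     (\<forall>i < dim_row X. \<forall>j < dim_col Y. fl_inner rd (row X i) (col Y j) (Z $$ (i, j)))"

definition fl_mult3 ::
  "(real \<Rightarrow> real \<Rightarrow> bool) \<Rightarrow> real mat \<Rightarrow> real mat \<Rightarrow> real mat \<Rightarrow> real mat \<Rightarrow> bool" where
  "fl_mult3 rd X Y Z W \<longleftrightarrow>
     (\<exists>V. fl_mult rd X Y V \<and> fl_mult rd V Z W) \<or> (\<exists>V. fl_mult rd Y Z V \<and> fl_mult rd X V W)"

section \<open>Gram-Schmidt QR factorization\<close>

datatype gs_variant = Classical | Modified

text \<open>\<open>gs_project rd var W Q S k v\<close>: \<open>v\<close> is the \<open>k\<close>-th column of \<open>W\<close> after orthogonalization
  against the columns \<open>j < k\<close> of \<open>Q\<close>, with coefficients \<open>S\<^sub>j\<^sub>k\<close>.  The classical variant takes the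
  coefficients from the original column, the modified variant from the current remainder.\<close>

fun gs_project :: "(real \<Rightarrow> real \<Rightarrow> bool) \<Rightarrow> gs_variant \<Rightarrow> real mat \<Rightarrow> real mat \<Rightarrow> real mat \<Rightarrow>
    nat \<Rightarrow> real vec \<Rightarrow> bool" where
  "gs_project rd Classical W Q S k v \<longleftrightarrow>
     (\<forall>j < k. fl_inner rd (col Q j) (col W k) (S $$ (j, k))) \<and>
     v \<in> carrier_vec (dim_row W) \<and>
     (\<forall>r < dim_row W. \<exists>y :: nat \<Rightarrow> real.
        (\<forall>j < k. rd (S $$ (j, k) * Q $$ (r, j)) (y j)) \<and>
        fl_sum rd (add_mset (W $$ (r, k)) (image_mset (\<lambda>j. - y j) (mset_set {..<k}))) (v $ r))"
| "gs_project rd Modified W Q S k v \<longleftrightarrow>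
     (\<exists>w :: nat \<Rightarrow> real vec. w 0 = col W k \<and> w k = v \<and>
        (\<forall>j < k. fl_inner rd (col Q j) (w j) (S $$ (j, k)) \<and>
           w (Suc j) \<in> carrier_vec (dim_row W) \<and>
           (\<forall>r < dim_row W. \<exists>y. rd (S $$ (j, k) * Q $$ (r, j)) y \<and>
              rd (w j $ r - y) (w (Suc j) $ r))))"

definition gs_qr :: "(real \<Rightarrow> real \<Rightarrow> bool) \<Rightarrow> gs_variant \<Rightarrow> real mat \<Rightarrow> real mat \<Rightarrow> real mat \<Rightarrow> bool"
  where
  "gs_qr rd var W Q S \<longleftrightarrow>
     Q \<in> carrier_mat (dim_row W) (dim_col W) \<and>
     S \<in> carrier_mat (dim_col W) (dim_col W) \<and> upper_triangular S \<and>
     (\<forall>k < dim_col W. \<exists>v. gs_project rd var W Q S k v \<and>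
        fl_norm rd v (S $$ (k, k)) \<and>
        (\<forall>r < dim_row W. rd (v $ r / S $$ (k, k)) (Q $$ (r, k))))"

definition qr_factorization :: "real mat \<Rightarrow> real mat \<Rightarrow> real mat \<Rightarrow> bool" where
  "qr_factorization W Q S \<longleftrightarrow>
     Q \<in> carrier_mat (dim_row W) (dim_col W) \<and>
     S \<in> carrier_mat (dim_col W) (dim_col W) \<and>
     transpose_mat Q * Q = 1\<^sub>m (dim_col W) \<and>
     upper_triangular S \<and> (\<forall>k < dim_col W. 0 < S $$ (k, k)) \<and>
     W = Q * S"

section \<open>The block Lanczos algorithm\<close>

text \<open>Block sequences are indexed as in the algorithm: \<open>U\<^sub>0, ..., U\<^sub>m\<close>, \<open>M\<^sub>1, ..., M\<^sub>m\<close>,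
  \<open>B\<^sub>1, ..., B\<^sub>m\<close> and \<open>R\<^sub>2, ..., R\<^sub>m\<close>; the other members of the sequences are irrelevant.\<close>

text \<open>Runs of the algorithm in exact arithmetic.\<close>

definition block_lanczos :: "nat \<Rightarrow> nat \<Rightarrow> real mat \<Rightarrow> real mat \<Rightarrow>
    (nat \<Rightarrow> real mat) \<Rightarrow> (nat \<Rightarrow> real mat) \<Rightarrow> (nat \<Rightarrow> real mat) \<Rightarrow> (nat \<Rightarrow> real mat) \<Rightarrow> bool" where
  "block_lanczos p m A U1 U R M B \<longleftrightarrow>
     square_mat A \<and> transpose_mat A = A \<and>
     U1 \<in> carrier_mat (dim_row A) p \<and> transpose_mat U1 * U1 = 1\<^sub>m p \<and>
     U 0 = U1 \<and> U 1 = U1 \<and> B 1 = 0\<^sub>m p p \<and>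
     M 1 = transpose_mat (U 1) * A * U 1 \<and>
     (\<forall>i \<in> {1..<m}.
        R (i + 1) = A * U i - U i * M i - U (i - 1) * transpose_mat (B i) \<and>
        qr_factorization (R (i + 1)) (U (i + 1)) (B (i + 1)) \<and>
        M (i + 1) = transpose_mat (U (i + 1)) * A * U (i + 1))"

text \<open>Runs of the algorithm in the arithmetic \<open>rd\<close>, with the arithmetic \<open>rdq\<close> in the QR
  factorizations.  The three terms of the recurrence may be combined in any order.\<close>

definition fl_block_lanczos :: "(real \<Rightarrow> real \<Rightarrow> bool) \<Rightarrow> (real \<Rightarrow> real \<Rightarrow> bool) \<Rightarrow> gs_variant \<Rightarrow>
    nat \<Rightarrow> nat \<Rightarrow> real mat \<Rightarrow> real mat \<Rightarrow>
    (nat \<Rightarrow> real mat) \<Rightarrow> (nat \<Rightarrow> real mat) \<Rightarrow> (nat \<Rightarrow> real mat) \<Rightarrow> (nat \<Rightarrow> real mat) \<Rightarrow> bool" where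
  "fl_block_lanczos rd rdq var p m A U1 U R M B \<longleftrightarrow>
     U 0 = U1 \<and> U 1 = U1 \<and> B 1 = 0\<^sub>m p p \<and>
     fl_mult3 rd (transpose_mat (U 1)) A (U 1) (M 1) \<and>
     (\<forall>i \<in> {1..<m}.
        (\<exists>X Y Z. fl_mult rd A (U i) X \<and> fl_mult rd (U i) (M i) Y \<and>
           fl_mult rd (U (i - 1)) (transpose_mat (B i)) Z \<and>
           R (i + 1) \<in> carrier_mat (dim_row A) p \<and>
           (\<forall>r < dim_row A. \<forall>c < p.
              fl_sum rd {# X $$ (r, c), - Y $$ (r, c), - Z $$ (r, c) #} (R (i + 1) $$ (r, c)))) \<and>
        gs_qr rdq var (R (i + 1)) (U (i + 1)) (B (i + 1)) \<and>
        fl_mult3 rd (transpose_mat (U (i + 1))) A (U (i + 1)) (M (i + 1)))"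

section \<open>Block matrices\<close>

text \<open>The \<open>p\<close> by \<open>p\<close> block in block row \<open>i\<close> and block column \<open>j\<close>, counted from zero.\<close>

definition block_of :: "nat \<Rightarrow> real mat \<Rightarrow> nat \<Rightarrow> nat \<Rightarrow> real mat" where
  "block_of p X i j = mat p p (\<lambda>(a, b). X $$ (i * p + a, j * p + b))"

definition signed_permutation_mat :: "nat \<Rightarrow> real mat \<Rightarrow> bool" where
  "signed_permutation_mat p X \<longleftrightarrow>
     (\<exists>\<pi> s. \<pi> permutes {..<p} \<and> (\<forall>i < p. s i = 1 \<or> s i = -1) \<and>
        X = mat p p (\<lambda>(i, j). if j = \<pi> i then s i else 0))"

definition signed_block_permutation_mat :: "nat \<Rightarrow> nat \<Rightarrow> real mat \<Rightarrow> bool" where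
  "signed_block_permutation_mat m p X \<longleftrightarrow>
     X \<in> carrier_mat (m * p) (m * p) \<and>
     (\<forall>i < m. \<exists>!j. j < m \<and> block_of p X i j \<noteq> 0\<^sub>m p p) \<and>
     (\<forall>j < m. \<exists>!i. i < m \<and> block_of p X i j \<noteq> 0\<^sub>m p p) \<and>
     (\<forall>i < m. \<forall>j < m. block_of p X i j \<noteq> 0\<^sub>m p p \<longrightarrow> signed_permutation_mat p (block_of p X i j))"

text \<open>Diagonal blocks \<open>M\<^sub>1, ..., M\<^sub>k\<close>, subdiagonal blocks \<open>B\<^sub>2, ..., B\<^sub>k\<close> and superdiagonal blocks
  their transposes.\<close>

definition block_tridiagonal ::
  "nat \<Rightarrow> nat \<Rightarrow> (nat \<Rightarrow> real mat) \<Rightarrow> (nat \<Rightarrow> real mat) \<Rightarrow> real mat" where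
  "block_tridiagonal p k M B = mat (k * p) (k * p) (\<lambda>(r, c).
     let i = r div p + 1; j = c div p + 1; a = r mod p; b = c mod p in
     if i = j then M i $$ (a, b)
     else if i = j + 1 then B i $$ (a, b)
     else if j = i + 1 then transpose_mat (B j) $$ (a, b)
     else 0)"

text \<open>The first block column of the identity, \<open>[I, 0, ..., 0]\<^sup>T\<close>.\<close>

definition first_block_column :: "nat \<Rightarrow> nat \<Rightarrow> real mat" where
  "first_block_column m p = mat (m * p) p (\<lambda>(i, j). if i = j then 1 else 0)"

end

theory Submission
  imports Defs
begin

text \<open>No rounding errors arise because every operation outside the norms of the Gram-Schmidt
  process has a floating point number as its exact value.  A signed block permutation matrix \<open>P\<close>
  is a signed permutation matrix, so the recurrence in exact arithmetic just walks through its block columns: with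
  \<open>V\<^sub>i\<close> the \<open>i\<close>-th block column of \<open>P\<close>, it produces \<open>U\<^sub>i = V\<^sub>i\<close> and the blocks of \<open>T\<close>
  (\<open>recurrence\<close>, \<open>diagonal_block\<close>); as the QR factorization with positive diagonal is
  unique (\<open>qr_factorization_unique\<close>), this is the only exact run.

  In floating point arithmetic, every product in the recurrence has a factor whose rows or columns
  contain at most one nonzero entry, \<open>1\<close> or \<open>-1\<close>.  So each inner product has at most one nonzero
  summand, which is plus or minus an entry of the other factor.  In the three-term combination for
  \<open>R\<^sub>i\<^sub>+\<^sub>1\<close>, each entry of \<open>A U\<^sub>i\<close> is either left alone or cancelled by exactly one of the two
  subtracted terms (\<open>recurrence_terms\<close>).  In all these sums the nonzero summands are among
  \<open>a\<close> and \<open>-a\<close> for a single floating point number \<open>a\<close>, hence every partial sum is \<open>0\<close>, \<open>a\<close> or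
  \<open>-a\<close>, and the result is exact for any order of the additions (\<open>fl_sum_cancelling\<close>).

  The Gram-Schmidt process receives \<open>V\<^sub>i\<^sub>+\<^sub>1 B\<close> with \<open>B\<close> upper triangular, that is, the rows of \<open>B\<close>
  up to sign, scattered among zero rows.  Its projections annihilate one entry of the current column
  after the other, again without rounding, until \<open>\<plusminus>B\<^sub>k\<^sub>k\<close> alone remains.  Genuine rounding occurs
  only in the norm: \<open>B\<^sub>k\<^sub>k\<^sup>2\<close> is rounded and the square root of the result is rounded.  In base 2 the
  two errors compensate, \<open>fl (sqrt (fl (x\<^sup>2))) = x\<close> (\<open>fl_sqrt_of_fl_square\<close>), provided that
  \<open>x\<^sup>2\<close> neither overflows nor underflows; this is where the range assumption enters.\<close>

section \<open>Rounding to nearest\<close>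

lemma floatsI:
  "x = of_int k * 2 powi (e - int t + 1) \<Longrightarrow> \<bar>k\<bar> < 2 ^ t \<Longrightarrow> 1 - emax \<le> e \<Longrightarrow> e \<le> emax \<Longrightarrow>
    x \<in> floats t emax"
  unfolding floats_def by blast

lemma floatsE:
  assumes "x \<in> floats t emax"
  obtains k e where "x = of_int k * 2 powi (e - int t + 1)" "\<bar>k\<bar> < 2 ^ t" "1 - emax \<le> e" "e \<le> emax"
  using assms unfolding floats_def by blast

lemma zero_in_floats: "1 \<le> emax \<Longrightarrow> 0 \<in> floats t emax"
  by (rule floatsI[of _ 0 1]) auto

lemma uminus_in_floats: "x \<in> floats t emax \<Longrightarrow> - x \<in> floats t emax"
proof (elim floatsE)
  fix k e
  assume "x = of_int k * 2 powi (e - int t + 1)" "\<bar>k\<bar> < 2 ^ t" "1 - emax \<le> e" "e \<le> emax"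
  then show "- x \<in> floats t emax" by (intro floatsI[of _ "- k" e]) auto
qed

lemma power_of_two_in_floats:
  assumes "1 \<le> t" "1 - emax \<le> e" "e \<le> emax"
  shows "2 powi e \<in> floats t emax"
proof (rule floatsI)
  have "real_of_int (2 ^ (t - 1)) = 2 powi (int t - 1)"
    using assms(1) by (simp add: power_int_def nat_diff_distrib)
  then show "2 powi e = real_of_int (2 ^ (t - 1)) * 2 powi (e - int t + 1)"
    by (simp flip: power_int_add)
qed (use assms in auto)

lemma one_in_floats: "ieee_format t emax \<Longrightarrow> 1 \<in> floats t emax"
  using power_of_two_in_floats[of t emax 0] by (simp add: ieee_format_def)

text \<open>The overflow threshold lies half a unit in the last place above the largest finite number.\<close>

lemma floats_not_overflow:
  assumes "x \<in> floats t emax" shows "\<not> overflows t emax x"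
proof -
  obtain k e where x: "x = real_of_int k * 2 powi (e - int t + 1)" and k: "\<bar>k\<bar> < 2 ^ t"
    and e: "e \<le> emax" using assms by (rule floatsE)
  have "\<bar>k\<bar> \<le> 2 ^ t - 1" using k by simp
  then have "real_of_int \<bar>k\<bar> \<le> real_of_int (2 ^ t - 1)" by (simp only: of_int_le_iff)
  then have "\<bar>real_of_int k\<bar> \<le> 2 ^ t - 1" by simp
  then have "\<bar>x\<bar> \<le> (2 ^ t - 1) * 2 powi (emax - int t + 1)"
    unfolding x abs_mult using e
    by (intro mult_mono) (auto intro: power_int_increasing)
  also have "\<dots> = 2 powi emax * (2 - 2 * 2 powi (- int t))"
    by (simp add: power_int_add power_int_diff power_int_minus field_simps)
  also have "\<dots> < 2 powi emax * (2 - 2 powi (- int t))"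
    by simp
  finally show ?thesis by (simp add: overflows_def)
qed

lemma fl_of_float:
  assumes "rounds_to_nearest t emax fl" "x \<in> floats t emax"
  shows "fl x = x"
proof -
  have "\<bar>x - fl x\<bar> \<le> \<bar>x - x\<bar>"
    using assms floats_not_overflow unfolding rounds_to_nearest_def by blast
  then show ?thesis by simp
qed

lemma two_powi_less_iff: "(2::real) powi a < 2 powi b \<longleftrightarrow> a < b"
proof
  show "a < b" if "(2::real) powi a < 2 powi b"
  proof (rule ccontr)
    assume "\<not> a < b"
    then have "(2::real) powi b \<le> 2 powi a" by (intro power_int_increasing) auto
    with that show False by simp
  qed
qed (simp add: power_int_strict_increasing)

lemma binade_exists:
  fixes x :: real assumes "0 < x"
  obtains e :: int where "2 powi e \<le> x" "x < 2 powi (e + 1)"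
proof
  have eq: "2 powi e = 2 powr real_of_int e" for e by (simp add: powr_real_of_int')
  show "2 powi \<lfloor>log 2 x\<rfloor> \<le> x" unfolding eq
    using assms by (simp add: powr_le_iff)
  show "x < 2 powi (\<lfloor>log 2 x\<rfloor> + 1)" unfolding eq
    using assms by (simp add: less_powr_iff del: of_int_add) linarith
qed

text \<open>The usual error bound for the binade \<open>[2\<^sup>E, 2\<^sup>E\<^sup>+\<^sup>1)\<close>, whose floating point numbers are the
  multiples of \<open>2\<^bsup>E-t+1\<^esup>\<close>: the multiple closest to \<open>x\<close> competes with \<open>fl x\<close>.\<close>

lemma rounding_error_le_half_ulp:
  assumes rn: "rounds_to_nearest t emax fl" and t: "1 \<le> t" and no: "\<not> overflows t emax x"
    and lo: "2 powi E \<le> x" and hi: "x < 2 powi (E + 1)" and E: "1 - emax \<le> E"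
  shows "\<bar>fl x - x\<bar> \<le> 2 powi (E - int t)"
proof -
  define g :: real where "g = 2 powi (E - int t + 1)"
  have g: "g > 0" by (simp add: g_def)
  have g2: "2 powi (E - int t) = g / 2" by (simp add: g_def power_int_add)
  have gt: "2 ^ t * g = 2 powi (E + 1)"
    by (simp add: g_def power_int_add power_int_diff)
  define k where "k = \<lfloor>x / g + 1 / 2\<rfloor>"
  have k1: "real_of_int k \<le> x / g + 1/2" and k2: "x / g + 1/2 < real_of_int k + 1"
    unfolding k_def by linarith+
  have x0: "0 < x" using lo by (rule less_le_trans[rotated]) simp
  have k0: "0 \<le> k" unfolding k_def using x0 g by simp
  have "x / g < 2 ^ t" using hi g gt by (simp add: field_simps)
  then have "real_of_int k < 2 ^ t + 1" using k1 by linarith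
  then have "real_of_int k < real_of_int (2 ^ t + 1)" by simp
  then have kle: "k \<le> 2 ^ t" by (simp only: of_int_less_iff)
  have xlt: "x < 2 powi emax * (2 - 2 powi (- int t))"
    using no x0 by (auto simp: overflows_def)
  have "x < 2 powi emax * 2" using xlt
    by (rule less_le_trans) simp
  then have "2 powi E < (2::real) powi (emax + 1)"
    using lo by (simp add: power_int_add)
  then have Em: "E \<le> emax"
    by (simp add: two_powi_less_iff)
  have mem: "real_of_int k * g \<in> floats t emax"
  proof (cases "k < 2 ^ t")
    case True
    then show ?thesis unfolding g_def using k0 E Em by (intro floatsI) auto
  next
    case False
    with kle have kt: "k = 2 ^ t" by simp
    \<comment> \<open>rounding up to \<open>2\<^sup>E\<^sup>+\<^sup>1\<close> in the topmost binade would be an overflow\<close>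
    have "E \<noteq> emax"
    proof
      assume "E = emax"
      then have "x < 2 ^ t * g * (1 - 2 powi (- int t) / 2)"
        using xlt gt by (simp add: power_int_add algebra_simps)
      also have "\<dots> = (2 ^ t - 1 / 2) * g" by (simp add: power_int_minus field_simps)
      finally have "x / g < 2 ^ t - 1/2" using g by (simp add: field_simps)
      with k1 kt show False by simp
    qed
    then have "2 powi (E + 1) \<in> floats t emax"
      using E Em t by (intro power_of_two_in_floats) auto
    then show ?thesis using gt kt by simp
  qed
  have "\<bar>x - fl x\<bar> \<le> \<bar>x - real_of_int k * g\<bar>"
    using rn no mem unfolding rounds_to_nearest_def by blast
  also have "\<dots> = \<bar>x / g - k\<bar> * g"
  proof -
    have "x - real_of_int k * g = (x / g - k) * g" using g by (simp add: left_diff_distrib)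
    then show ?thesis using g by (simp add: abs_mult)
  qed
  also have "\<dots> \<le> 1/2 * g"
  proof (rule mult_right_mono)
    show "\<bar>x / g - k\<bar> \<le> 1/2" using k1 k2 by linarith
  qed (use g in simp)
  finally show ?thesis using g2 by (simp add: abs_minus_commute)
qed

text \<open>Above \<open>2\<^sup>e\<close> the neighbours of a floating point number are at least the spacing of the binade
  of exponent \<open>e\<close> away.  At \<open>2\<^sup>e\<close> itself this fails, since the spacing halves below it.\<close>

lemma float_gap:
  assumes x: "x \<in> floats t emax" and f: "f \<in> floats t emax" and ne: "f \<noteq> x"
    and lo: "2 powi e < x" and t: "1 \<le> t"
  shows "2 powi (e - int t + 1) \<le> \<bar>f - x\<bar>"
proof -
  define g :: real where "g = 2 powi (e - int t + 1)"
  have g: "g > 0" by (simp add: g_def)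
  have grid: "\<exists>j::int. real_of_int k * 2 powi (e' - int t + 1) = of_int j * g" if "e \<le> e'" for k e'
  proof -
    have "(2::real) powi (e' - int t + 1) = 2 ^ nat (e' - e) * g"
    proof -
      have "e' - int t + 1 = (e' - e) + (e - int t + 1)" by simp
      then have "(2::real) powi (e' - int t + 1) = 2 powi (e' - e) * g"
        unfolding g_def by (metis power_int_add zero_neq_numeral)
      then show ?thesis using that by (simp add: power_int_def)
    qed
    then show ?thesis by (intro exI[of _ "k * 2 ^ nat (e' - e)"]) simp
  qed
  have gap: "g \<le> \<bar>a - b\<bar>" if "a = of_int i * g" "b = of_int j * g" "a \<noteq> b" for a b and i j :: int
  proof -
    have "1 \<le> \<bar>i - j\<bar>" using that by auto
    then have "1 \<le> \<bar>real_of_int i - real_of_int j\<bar>" by linarith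
    then have "g \<le> \<bar>real_of_int i - real_of_int j\<bar> * g" using g by simp
    then show ?thesis using that g by (simp add: abs_mult flip: left_diff_distrib)
  qed
  have small: "\<bar>real_of_int k * 2 powi (e' - int t + 1)\<bar> < 2 powi (e' + 1)" if "\<bar>k\<bar> < 2 ^ t" for k e' :: int
  proof -
    have "real_of_int \<bar>k\<bar> < 2 ^ t" using that
      by (metis of_int_less_iff of_int_power of_int_numeral)
    then have "\<bar>real_of_int k\<bar> * 2 powi (e' - int t + 1) < 2 ^ t * 2 powi (e' - int t + 1)"
      by simp
    then show ?thesis by (simp add: abs_mult power_int_add power_int_diff)
  qed
  obtain kx ex where kx: "x = real_of_int kx * 2 powi (ex - int t + 1)" "\<bar>kx\<bar> < 2 ^ t"
    using x by (rule floatsE)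
  have "2 powi e < (2::real) powi (ex + 1)" using small[OF kx(2), of ex] kx(1) lo by linarith
  then have "e \<le> ex"
    by (simp add: two_powi_less_iff)
  then obtain jx :: int where jx: "x = of_int jx * g" using grid kx(1) by metis
  obtain kf ef where kf: "f = real_of_int kf * 2 powi (ef - int t + 1)" "\<bar>kf\<bar> < 2 ^ t"
    using f by (rule floatsE)
  show ?thesis
  proof (cases "e \<le> ef")
    case True
    then obtain jf :: int where "f = of_int jf * g" using grid kf(1) by metis
    then show ?thesis using gap[OF _ jx ne] g_def by simp
  next
    case False
    have "f < 2 powi (ef + 1)" using small[OF kf(2), of ef] kf(1) by linarith
    also have "\<dots> \<le> 2 powi e" using False by (intro power_int_increasing) auto
    finally have fl: "f < 2 powi e" .
    have "(2::real) powi e = of_int (2 ^ (t - 1)) * g"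
    proof -
      have "real_of_int (2 ^ (t - 1)) = 2 powi (int t - 1)"
        using t by (simp add: power_int_def nat_diff_distrib)
      then show ?thesis unfolding g_def by (simp flip: power_int_add)
    qed
    then have "g \<le> \<bar>x - 2 powi e\<bar>" using gap[OF jx] lo by blast
    then show ?thesis using fl lo g_def by linarith
  qed
qed

text \<open>With \<open>2\<^sup>e < x < 2\<^sup>e\<^sup>+\<^sup>1\<close> and \<open>y = fl (x\<^sup>2)\<close>, the identity
  \<open>sqrt y - x = (y - x\<^sup>2) / (sqrt y + x)\<close> divides an error of at most \<open>2\<^bsup>2e+1-t\<^esup>\<close> by more than
  \<open>2\<^sup>e\<^sup>+\<^sup>1\<close>.  So \<open>sqrt y\<close> is closer to \<open>x\<close> than half the gap between \<open>x\<close> and its neighbours, and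
  rounds to \<open>x\<close>.  Base 2 matters: the error bound is too weak for this in larger bases.\<close>

lemma fl_sqrt_of_fl_square:
  assumes fmt: "ieee_format t emax" and rn: "rounds_to_nearest t emax fl"
    and x: "x \<in> floats t emax" "0 < x"
    and no: "\<not> overflows t emax (x * x)" and nu: "\<not> underflows t emax (x * x)"
    and no': "\<not> overflows t emax (sqrt (fl (x * x)))"
  shows "fl (sqrt (fl (x * x))) = x"
proof (cases "x * x \<in> floats t emax")
  case True
  then show ?thesis using x by (simp add: fl_of_float[OF rn])
next
  case inexact: False
  have t: "1 \<le> t" "1 \<le> emax" using fmt by (auto simp: ieee_format_def)
  have big: "2 powi (1 - emax) \<le> x * x" using nu inexact x by (auto simp: underflows_def)
  obtain e where e: "2 powi e \<le> x" "x < 2 powi (e + 1)" using binade_exists[OF x(2)] .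
  have xx0: "0 < x * x" using x by simp
  obtain E where E: "2 powi E \<le> x * x" "x * x < 2 powi (E + 1)" using binade_exists[OF xx0] .
  have sq: "(2::real) powi a * 2 powi a = 2 powi (2 * a)" for a
    by (simp flip: power_int_add)
  have "(2::real) powi (1 - emax) < 2 powi (E + 1)" using big E by linarith
  then have E1: "1 - emax \<le> E" by (simp add: two_powi_less_iff)
  have "x * x < 2 powi emax * (2 - 2 powi (- int t))"
    using no xx0 by (auto simp: overflows_def)
  also have "\<dots> \<le> 2 powi (emax + 1)" by (simp add: power_int_add)
  finally have "2 powi E < (2::real) powi (emax + 1)" using E by linarith
  then have E2: "E \<le> emax" by (simp add: two_powi_less_iff)
  have "2 powi e * 2 powi e \<le> x * x" using e x by (intro mult_mono) auto
  then have "(2::real) powi (2 * e) < 2 powi (E + 1)" using E sq[of e] by linarith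
  then have E3: "2 * e \<le> E" by (simp add: two_powi_less_iff)
  have "x * x < 2 powi (e + 1) * 2 powi (e + 1)" using e x by (intro mult_strict_mono) auto
  then have "(2::real) powi E < 2 powi (2 * (e + 1))" using E sq[of "e + 1"] by linarith
  then have E4: "E \<le> 2 * e + 1" by (simp add: two_powi_less_iff)
  \<comment> \<open>\<open>x * x\<close> lies in the binade of exponent \<open>E\<close>, which is \<open>2 * e\<close> or \<open>2 * e + 1\<close>\<close>
  define y where "y = fl (x * x)"
  have EF: "2 powi E \<in> floats t emax" using power_of_two_in_floats t E1 E2 by blast
  have near: "\<bar>x * x - y\<bar> \<le> \<bar>x * x - f\<bar>" if "f \<in> floats t emax" for f
    using rn no that unfolding rounds_to_nearest_def y_def by blast
  have "2 powi E \<le> y" using near[OF EF] E(1) by linarith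
  moreover have "(2::real) powi (2 * e) \<le> 2 powi E" using E3 by (intro power_int_increasing) auto
  ultimately have y: "2 powi e * 2 powi e \<le> y" using sq[of e] by linarith
  have sy: "2 powi e \<le> sqrt y" using y by (intro real_le_rsqrt) (simp add: power2_eq_square)
  \<comment> \<open>the square of a power of two would be exact\<close>
  have "x \<noteq> 2 powi e"
  proof
    assume xe: "x = 2 powi e"
    then have "x * x = 2 powi (2 * e)" using sq by simp
    moreover have "2 * e = E"
    proof -
      have "(2::real) powi E \<le> 2 powi (2 * e)" using E(1) xe sq by simp
      then have "\<not> (2::real) powi (2 * e) < 2 powi E" by simp
      then show ?thesis using E3 by (simp add: two_powi_less_iff)
    qed
    ultimately show False using EF inexact by simp
  qed
  then have xe: "2 powi e < x" using e by simp
  have "0 \<le> 2 powi e * (2::real) powi e" by simp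
  then have y0: "0 \<le> y" using y by linarith
  have sum_pos: "0 < sqrt y + x" using y0 x by (simp add: add_nonneg_pos)
  have "y - x * x = (sqrt y - x) * (sqrt y + x)" using y0 by (simp add: algebra_simps)
  then have "\<bar>sqrt y - x\<bar> * (sqrt y + x) = \<bar>y - x * x\<bar>" using sum_pos by (simp add: abs_mult)
  also have "\<dots> \<le> 2 powi (E - int t)"
    unfolding y_def using rounding_error_le_half_ulp[OF rn t(1) no E E1] .
  also have "\<dots> \<le> 2 powi (2 * e + 1 - int t)" using E4 by (intro power_int_increasing) auto
  also have "\<dots> = 2 powi (e - int t) * (2 * 2 powi e)"
  proof -
    have "2 * e + 1 - int t = (e - int t) + (1 + e)" by simp
    then have "(2::real) powi (2 * e + 1 - int t) = 2 powi (e - int t) * 2 powi (1 + e)"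
      by (metis power_int_add zero_neq_numeral)
    then show ?thesis by (simp add: power_int_add)
  qed
  also have "\<dots> < 2 powi (e - int t) * (sqrt y + x)" using sy xe by simp
  finally have close: "\<bar>sqrt y - x\<bar> < 2 powi (e - int t)"
    using sum_pos by (simp add: mult_less_cancel_right_pos)
  have fin: "fl (sqrt y) \<in> floats t emax" and nr: "\<bar>sqrt y - fl (sqrt y)\<bar> \<le> \<bar>sqrt y - x\<bar>"
    using rn no' x(1) unfolding rounds_to_nearest_def y_def by blast+
  have "\<bar>fl (sqrt y) - x\<bar> < 2 * 2 powi (e - int t)" using close nr by linarith
  also have "\<dots> = 2 powi (e - int t + 1)" by (simp add: power_int_add)
  finally show ?thesis
    using float_gap[OF x(1) fin _ xe t(1)] unfolding y_def by linarith
qed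

section \<open>Exact evaluation of sparse sums and products\<close>

text \<open>All that is required of an arithmetic: operations whose exact value lies in \<open>F\<close> deliver it.
  Other operations may deliver anything, so the proofs below have to show for each operation that
  its exact value lies in \<open>F\<close>.\<close>

locale exact_arithmetic =
  fixes F :: "real set" and rd :: "real \<Rightarrow> real \<Rightarrow> bool"
  assumes zero_mem: "0 \<in> F" and uminus_mem: "x \<in> F \<Longrightarrow> - x \<in> F"
    and exact: "rd x z \<Longrightarrow> x \<in> F \<Longrightarrow> z = x"

lemma subseteq_add_mset_cases:
  assumes "Y \<subseteq># add_mset x A"
  obtains "Y \<subseteq># A" | Z where "Y = add_mset x Z" "Z \<subseteq># A"
proof (cases "x \<in># Y")
  case True
  then obtain Z where Z: "Y = add_mset x Z" by (metis mset_add)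
  then show ?thesis using assms that(2) by auto
next
  case False
  have "Y \<subseteq># A"
  proof (rule mset_subset_eqI)
    fix y show "count Y y \<le> count A y"
      using mset_subset_eq_count[OF assms, of y] False
      by (cases "y = x") (auto simp: not_in_iff)
  qed
  then show ?thesis using that(1) by blast
qed

lemma sum_mset_filter_nonzero:
  fixes Y :: "'a :: comm_monoid_add multiset"
  shows "sum_mset (filter_mset (\<lambda>x. x \<noteq> 0) Y) = sum_mset Y"
  by (induction Y) auto

lemma filter_nonzero_image_mset_le_single:
  fixes y :: "nat \<Rightarrow> real"
  assumes "finite I" "k \<in> I" "\<And>l. l \<in> I \<Longrightarrow> l \<noteq> k \<Longrightarrow> y l = 0"
  shows "filter_mset (\<lambda>x. x \<noteq> 0) (image_mset y (mset_set I)) \<subseteq># {#y k#}"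
proof -
  have "{l \<in> I. y l \<noteq> 0} \<subseteq> {k}" using assms by auto
  then have "mset_set {l \<in> I. y l \<noteq> 0} \<subseteq># mset_set {k}" by (intro subset_imp_msubset_mset_set) auto
  then have "image_mset y (mset_set {l \<in> I. y l \<noteq> 0}) \<subseteq># {#y k#}"
    using image_mset_subseteq_mono by fastforce
  then show ?thesis using assms(1) by (simp add: filter_mset_image_mset)
qed

lemma filter_nonzero_image_mset_empty:
  fixes y :: "nat \<Rightarrow> real"
  assumes "finite I" "\<And>l. l \<in> I \<Longrightarrow> y l = 0"
  shows "filter_mset (\<lambda>x. x \<noteq> 0) (image_mset y (mset_set I)) = {#}"
  using assms by (auto simp: filter_mset_eq_conv filter_empty_mset)

context exact_arithmetic
begin

text \<open>Whatever the parenthesization, each intermediate result is the sum of a submultiset.\<close>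

lemma fl_sum_eq_sum_mset:
  assumes "fl_sum rd X z" "\<And>Y. Y \<subseteq># X \<Longrightarrow> sum_mset Y \<in> F"
  shows "z = sum_mset X"
  using assms
proof (induction rule: fl_sum.induct)
  case (add X x Y y z)
  have "x = sum_mset X" using add.IH(1) add.prems
    by (meson mset_subset_eq_add_left subset_mset.order_trans)
  moreover have "y = sum_mset Y" using add.IH(2) add.prems
    by (meson mset_subset_eq_add_right subset_mset.order_trans)
  ultimately have "x + y = sum_mset (X + Y)" by simp
  moreover have "sum_mset (X + Y) \<in> F" using add.prems by blast
  ultimately show ?case using exact[OF add.hyps(3)] by simp
qed auto

text \<open>The situation of every sum below: a single number occurs, at most once with each sign, among
  zeros.\<close>

lemma fl_sum_cancelling:
  assumes s: "fl_sum rd X z" and X: "filter_mset (\<lambda>x. x \<noteq> 0) X \<subseteq># {#a, - a#}" and a: "a \<in> F"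
  shows "z = sum_mset X"
proof (rule fl_sum_eq_sum_mset[OF s])
  have sub: "sum_mset Z \<in> {0, a, - a}" if "Z \<subseteq># {#a, - a#}" for Z
    using that
  proof (cases rule: subseteq_add_mset_cases)
    case 1
    then show ?thesis by (cases rule: subseteq_add_mset_cases) auto
  next
    case (2 Z')
    from 2(2) show ?thesis unfolding 2(1) by (cases rule: subseteq_add_mset_cases) auto
  qed
  fix Y assume "Y \<subseteq># X"
  then have "filter_mset (\<lambda>x. x \<noteq> 0) Y \<subseteq># {#a, - a#}"
    using X multiset_filter_mono subset_mset.order_trans by blast
  from sub[OF this] have "sum_mset (filter_mset (\<lambda>x. x \<noteq> 0) Y) \<in> {0, a, - a}" .
  then show "sum_mset Y \<in> F"
    using a zero_mem uminus_mem unfolding sum_mset_filter_nonzero by auto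
qed

lemma fl_sum_single_nonzero:
  fixes I :: "nat set"
  assumes s: "fl_sum rd (image_mset y (mset_set I)) z" and "finite I" "k \<in> I" "y k \<in> F"
    and "\<And>l. l \<in> I \<Longrightarrow> l \<noteq> k \<Longrightarrow> y l = 0"
  shows "z = y k"
proof -
  have "filter_mset (\<lambda>x. x \<noteq> 0) (image_mset y (mset_set I)) \<subseteq># {#y k, - y k#}"
    using filter_nonzero_image_mset_le_single[of I k y] assms(2-5)
    by (meson mset_subset_eq_add_left subset_mset.order_trans mset_subset_eq_add_mset_cancel empty_le)
  then have "z = sum_mset (image_mset y (mset_set I))" using fl_sum_cancelling[OF s] assms(4) by blast
  also have "\<dots> = sum y I" by (simp add: sum_unfold_sum_mset)
  also have "\<dots> = y k" using assms(2,3,5) by (subst sum.remove[of _ k]) auto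
  finally show ?thesis .
qed

lemma fl_inner_single_nonzero:
  assumes i: "fl_inner rd v w z" and k: "k < dim_vec w" "v $ k * w $ k \<in> F"
    and 0: "\<And>l. l < dim_vec w \<Longrightarrow> l \<noteq> k \<Longrightarrow> v $ l * w $ l = 0"
  shows "z = v $ k * w $ k"
proof -
  obtain y where y: "\<And>l. l < dim_vec v \<Longrightarrow> rd (v $ l * w $ l) (y l)"
    and s: "fl_sum rd (image_mset y (mset_set {..<dim_vec v})) z" and d: "dim_vec v = dim_vec w"
    using i unfolding fl_inner_def by blast
  have "y l = v $ l * w $ l" if "l < dim_vec v" for l
    using exact[OF y[OF that]] k 0 that d zero_mem by (cases "l = k") auto
  then show ?thesis using fl_sum_single_nonzero[OF s, of k] k 0 d by auto
qed

end

lemma elements_mat_eq: "elements_mat A = {A $$ (i, j) | i j. i < dim_row A \<and> j < dim_col A}"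
  unfolding elements_mat_def by force

lemma elements_mat_transpose: "elements_mat (transpose_mat (X :: real mat)) = elements_mat X"
proof -
  have sub: "elements_mat (transpose_mat Y) \<subseteq> elements_mat Y" for Y :: "real mat"
    by (auto dest!: elements_matD intro!: elements_matI[of _ "dim_row Y" "dim_col Y"])
  show ?thesis using sub[of X] sub[of "transpose_mat X"] by simp
qed

lemma fl_inner_commute: "fl_inner rd v w z \<longleftrightarrow> fl_inner rd w v z"
  by (cases "dim_vec v = dim_vec w") (simp_all add: fl_inner_def mult.commute)

lemma fl_mult_transpose:
  assumes "fl_mult rd X Y Z"
  shows "fl_mult rd (transpose_mat Y) (transpose_mat X) (transpose_mat Z)"
  unfolding fl_mult_def
proof (intro conjI allI impI)
  fix i j assume "i < dim_row (transpose_mat Y)" "j < dim_col (transpose_mat X)"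
  then have ij: "i < dim_col Y" "j < dim_row X" by auto
  then have "fl_inner rd (row X j) (col Y i) (Z $$ (j, i))" "Z \<in> carrier_mat (dim_row X) (dim_col Y)"
    using assms unfolding fl_mult_def by auto
  then show "fl_inner rd (row (transpose_mat Y) i) (col (transpose_mat X) j) (transpose_mat Z $$ (i, j))"
    using ij by (subst fl_inner_commute) simp
qed (use assms in \<open>auto simp: fl_mult_def\<close>)

lemma transpose_mat_mult:
  fixes X Y :: "real mat"
  shows "dim_col X = dim_row Y \<Longrightarrow> transpose_mat (X * Y) = transpose_mat Y * transpose_mat X"
  by (rule transpose_mult[of X "dim_row X" "dim_col X" Y "dim_col Y"]) (auto intro!: carrier_matI)

text \<open>Zero rows are admitted, since the block columns of a permutation matrix have them.\<close>

definition signed_unit_rows :: "real mat \<Rightarrow> bool" where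
  "signed_unit_rows X \<longleftrightarrow> (\<forall>i < dim_row X. \<forall>j < dim_col X.
     X $$ (i, j) \<in> {0, 1, - 1} \<and>
     (X $$ (i, j) \<noteq> 0 \<longrightarrow> (\<forall>l < dim_col X. l \<noteq> j \<longrightarrow> X $$ (i, l) = 0)))"

lemma scalar_prod_single_nonzero:
  fixes v w :: "real vec"
  assumes "k < dim_vec w" "\<And>l. l < dim_vec w \<Longrightarrow> l \<noteq> k \<Longrightarrow> v $ l * w $ l = 0"
  shows "v \<bullet> w = v $ k * w $ k"
  unfolding scalar_prod_def using assms(1)
  by (subst sum.remove[of _ k]) (auto intro!: sum.neutral simp: assms(2) simp del: mult_eq_0_iff)

text \<open>A zero row is covered as well: then any position serves as \<open>k\<close>.\<close>

lemma signed_unit_row_cases: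
  assumes "signed_unit_rows X" "i < dim_row X" "0 < dim_col X"
  obtains k where "k < dim_col X" "X $$ (i, k) \<in> {0, 1, - 1}"
    "\<And>l. l < dim_col X \<Longrightarrow> l \<noteq> k \<Longrightarrow> X $$ (i, l) = 0"
proof (cases "\<exists>k < dim_col X. X $$ (i, k) \<noteq> 0")
  case True
  then show ?thesis using assms that unfolding signed_unit_rows_def by blast
next
  case False
  then show ?thesis using assms that[of 0] by auto
qed

context exact_arithmetic
begin

lemma signed_unit_mult_mem: "u \<in> {0, 1, - 1} \<Longrightarrow> x \<in> F \<Longrightarrow> u * x \<in> F"
  by (auto intro: zero_mem uminus_mem)

lemma signed_unit_rows_mult_mem:
  assumes X: "signed_unit_rows X" and Y: "elements_mat Y \<subseteq> F" and d: "dim_col X = dim_row Y"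
  shows "elements_mat (X * Y) \<subseteq> F"
proof
  fix z assume "z \<in> elements_mat (X * Y)"
  then obtain i j where ij: "i < dim_row X" "j < dim_col Y" "z = row X i \<bullet> col Y j"
    by (auto simp: elements_mat_eq)
  show "z \<in> F"
  proof (cases "dim_col X = 0")
    case True
    then show ?thesis using ij d zero_mem by (simp add: scalar_prod_def)
  next
    case False
    then obtain k where k: "k < dim_col X" "X $$ (i, k) \<in> {0, 1, - 1}"
      "\<And>l. l < dim_col X \<Longrightarrow> l \<noteq> k \<Longrightarrow> X $$ (i, l) = 0"
      using signed_unit_row_cases[OF X ij(1)] by blast
    have "z = X $$ (i, k) * Y $$ (k, j)"
      unfolding ij(3) using scalar_prod_single_nonzero[of k "col Y j" "row X i"] k ij d by auto
    moreover have "Y $$ (k, j) \<in> F" using Y k ij d by (auto simp: elements_mat_eq)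
    ultimately show ?thesis using signed_unit_mult_mem k by auto
  qed
qed

text \<open>Such a factor only selects and negates entries, so that each inner product has at most one
  nonzero term.\<close>

lemma fl_mult_signed_unit_rows:
  assumes Z: "fl_mult rd X Y Z" and X: "signed_unit_rows X" and Y: "elements_mat Y \<subseteq> F"
    and d: "dim_col X = dim_row Y" "0 < dim_row Y"
  shows "Z = X * Y"
proof (rule eq_matI)
  fix i j assume "i < dim_row (X * Y)" "j < dim_col (X * Y)"
  then have ij: "i < dim_row X" "j < dim_col Y" by auto
  obtain k where k: "k < dim_col X" "X $$ (i, k) \<in> {0, 1, - 1}"
    "\<And>l. l < dim_col X \<Longrightarrow> l \<noteq> k \<Longrightarrow> X $$ (i, l) = 0"
    using signed_unit_row_cases[OF X ij(1)] d by auto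
  have "Y $$ (k, j) \<in> F" using Y k ij d by (auto simp: elements_mat_eq)
  then have "row X i $ k * col Y j $ k \<in> F" using k ij d signed_unit_mult_mem by simp
  moreover have "fl_inner rd (row X i) (col Y j) (Z $$ (i, j))"
    using Z ij unfolding fl_mult_def by blast
  ultimately have "Z $$ (i, j) = row X i $ k * col Y j $ k"
    using fl_inner_single_nonzero[of "row X i" "col Y j" _ k] k ij d by simp
  also have "\<dots> = row X i \<bullet> col Y j"
    using scalar_prod_single_nonzero[of k "col Y j" "row X i"] k ij d by auto
  finally show "Z $$ (i, j) = (X * Y) $$ (i, j)" using ij by simp
qed (use Z in \<open>auto simp: fl_mult_def\<close>)

lemma fl_mult_signed_unit_cols:
  assumes Z: "fl_mult rd X Y Z" and Y: "signed_unit_rows (transpose_mat Y)" and X: "elements_mat X \<subseteq> F"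
    and d: "dim_col X = dim_row Y" "0 < dim_row Y"
  shows "Z = X * Y"
proof -
  have "transpose_mat Z = transpose_mat Y * transpose_mat X"
    using fl_mult_signed_unit_rows[OF fl_mult_transpose[OF Z] Y] X d
    by (simp add: elements_mat_transpose)
  also have "\<dots> = transpose_mat (X * Y)" using d by (simp add: transpose_mat_mult)
  finally have "transpose_mat (transpose_mat Z) = transpose_mat (transpose_mat (X * Y))" by simp
  then show ?thesis by simp
qed

lemma signed_unit_cols_mult_mem:
  assumes Y: "signed_unit_rows (transpose_mat Y)" and X: "elements_mat X \<subseteq> F"
    and d: "dim_col X = dim_row Y"
  shows "elements_mat (X * Y) \<subseteq> F"
proof -
  have "elements_mat (transpose_mat Y * transpose_mat X) \<subseteq> F"
    using signed_unit_rows_mult_mem[OF Y] X d by (simp add: elements_mat_transpose)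
  also have "transpose_mat Y * transpose_mat X = transpose_mat (X * Y)"
    using d by (simp add: transpose_mat_mult)
  finally show ?thesis by (simp add: elements_mat_transpose)
qed

lemma fl_mult3_signed_unit_cols:
  assumes W: "fl_mult3 rd (transpose_mat X) A X W" and X: "signed_unit_rows (transpose_mat X)"
    and A: "elements_mat A \<subseteq> F" "A \<in> carrier_mat n n" "X \<in> carrier_mat n q" "0 < n"
  shows "W = transpose_mat X * A * X"
proof -
  have l: "elements_mat (transpose_mat X * A) \<subseteq> F" "elements_mat (A * X) \<subseteq> F"
    using signed_unit_rows_mult_mem[OF X A(1)] signed_unit_cols_mult_mem[OF X A(1)] A by auto
  show ?thesis using W unfolding fl_mult3_def
  proof (elim disjE exE conjE)
    fix V assume V: "fl_mult rd (transpose_mat X) A V" "fl_mult rd V X W"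
    have "V = transpose_mat X * A" using fl_mult_signed_unit_rows[OF V(1) X] A by simp
    then show ?thesis using fl_mult_signed_unit_cols[OF V(2) X] l A by simp
  next
    fix V assume V: "fl_mult rd A X V" "fl_mult rd (transpose_mat X) V W"
    have "V = A * X" using fl_mult_signed_unit_cols[OF V(1) X] A by simp
    then have "W = transpose_mat X * (A * X)" using fl_mult_signed_unit_rows[OF V(2) X] l A by simp
    also have "\<dots> = transpose_mat X * A * X" using A by (simp add: assoc_mult_mat[of "transpose_mat X" q n A n X q])
    finally show ?thesis .
  qed
qed

end

section \<open>Signed selection matrices\<close>

text \<open>Column \<open>k\<close> is the unit vector with index \<open>\<rho> k\<close>, multiplied by the sign \<open>s k\<close>.  Signed permutation
  matrices and their block columns both have this form.\<close>

definition signed_selection :: "nat \<Rightarrow> nat \<Rightarrow> (nat \<Rightarrow> nat) \<Rightarrow> (nat \<Rightarrow> real) \<Rightarrow> real mat" where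
  "signed_selection n q \<rho> s = mat n q (\<lambda>(r, k). if r = \<rho> k then s k else 0)"

locale selection =
  fixes n q :: nat and \<rho> :: "nat \<Rightarrow> nat" and s :: "nat \<Rightarrow> real"
  assumes inj: "inj_on \<rho> {..<q}" and less: "k < q \<Longrightarrow> \<rho> k < n" and sign: "k < q \<Longrightarrow> s k \<in> {1, - 1}"
begin

abbreviation X where "X \<equiv> signed_selection n q \<rho> s"

lemma carrier [simp]: "X \<in> carrier_mat n q" "dim_row X = n" "dim_col X = q"
  by (simp_all add: signed_selection_def)

lemma index: "r < n \<Longrightarrow> k < q \<Longrightarrow> X $$ (r, k) = (if r = \<rho> k then s k else 0)"
  by (simp add: signed_selection_def)

lemma sign_square: "k < q \<Longrightarrow> s k * s k = 1"
  using sign[of k] by auto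

lemma inj_eq: "j < q \<Longrightarrow> k < q \<Longrightarrow> \<rho> j = \<rho> k \<longleftrightarrow> j = k"
  using inj by (auto simp: inj_on_def)

lemma signed_unit_rows: "signed_unit_rows X"
  unfolding signed_unit_rows_def
proof (intro allI impI conjI)
  fix i j assume "i < dim_row X" "j < dim_col X"
  then have ij: "i < n" "j < q" by auto
  then show "X $$ (i, j) \<in> {0, 1, - 1}" using sign[OF ij(2)] by (simp add: index)
  fix l assume "X $$ (i, j) \<noteq> 0" "l < dim_col X" "l \<noteq> j"
  then show "X $$ (i, l) = 0" using ij inj_eq[of j l] by (auto simp: index split: if_splits)
qed

lemma signed_unit_rows_transpose: "signed_unit_rows (transpose_mat X)"
  unfolding signed_unit_rows_def
proof (intro allI impI conjI)
  fix i j assume "i < dim_row (transpose_mat X)" "j < dim_col (transpose_mat X)"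
  then have ij: "i < q" "j < n" by auto
  then show "transpose_mat X $$ (i, j) \<in> {0, 1, - 1}" using sign[OF ij(1)] by (simp add: index)
  fix l assume "transpose_mat X $$ (i, j) \<noteq> 0" "l < dim_col (transpose_mat X)" "l \<noteq> j"
  then show "transpose_mat X $$ (i, l) = 0" using ij by (auto simp: index split: if_splits)
qed

lemma mult_index:
  assumes "K \<in> carrier_mat q l" "k < q" "c < l"
  shows "(X * K) $$ (\<rho> k, c) = s k * K $$ (k, c)"
proof -
  have "(X * K) $$ (\<rho> k, c) = row X (\<rho> k) \<bullet> col K c"
    using assms less by simp
  also have "\<dots> = row X (\<rho> k) $ k * col K c $ k"
    using assms less inj_eq by (intro scalar_prod_single_nonzero) (auto simp: index)
  finally show ?thesis using assms less by (simp add: index)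
qed

lemma mult_index_outside:
  assumes "K \<in> carrier_mat q l" "r < n" "r \<notin> \<rho> ` {..<q}" "c < l"
  shows "(X * K) $$ (r, c) = 0"
proof -
  have "(X * K) $$ (r, c) = (\<Sum>k < q. X $$ (r, k) * K $$ (k, c))"
    using assms by (simp add: scalar_prod_def atLeast0LessThan)
  also have "\<dots> = 0" using assms by (intro sum.neutral) (auto simp: index)
  finally show ?thesis .
qed

lemma transpose_mult_index:
  assumes "K \<in> carrier_mat n l" "k < q" "c < l"
  shows "(transpose_mat X * K) $$ (k, c) = s k * K $$ (\<rho> k, c)"
proof -
  have "(transpose_mat X * K) $$ (k, c) = col X k \<bullet> col K c"
    using assms by simp
  also have "\<dots> = col X k $ \<rho> k * col K c $ \<rho> k"
    using assms less by (intro scalar_prod_single_nonzero) (auto simp: index)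
  finally show ?thesis using assms less by (simp add: index)
qed

lemma mult_right_index:
  assumes "K \<in> carrier_mat l n" "i < l" "k < q"
  shows "(K * X) $$ (i, k) = K $$ (i, \<rho> k) * s k"
proof -
  have "(K * X) $$ (i, k) = row K i \<bullet> col X k"
    using assms by simp
  also have "\<dots> = row K i $ \<rho> k * col X k $ \<rho> k"
    using assms less by (intro scalar_prod_single_nonzero) (auto simp: index)
  finally show ?thesis using assms less by (simp add: index)
qed

lemma orthonormal: "transpose_mat X * X = 1\<^sub>m q"
proof (rule eq_matI)
  fix i j assume "i < dim_row (1\<^sub>m q)" "j < dim_col (1\<^sub>m q)"
  then have "i < q" "j < q" by auto
  then show "(transpose_mat X * X) $$ (i, j) = 1\<^sub>m q $$ (i, j)"
    using transpose_mult_index[of X q i j] less sign_square inj_eq by (auto simp: index)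
qed auto

end

section \<open>Gram-Schmidt orthogonalization of a row-permuted triangular matrix\<close>

text \<open>The two assumptions about squares isolate what the norm computation needs beyond exactness: the
  rounded square lies in \<open>F\<close>, so that summing it with zeros changes nothing, and its square root
  rounds back.\<close>

locale gram_schmidt_input = exact_arithmetic F rd + selection n p \<rho> s
  for F rd n p \<rho> s +
  fixes B W :: "real mat"
  assumes W: "W = X * B" and B: "B \<in> carrier_mat p p" "elements_mat B \<subseteq> F" "upper_triangular B"
    and diag: "k < p \<Longrightarrow> 0 < B $$ (k, k)"
    and one_mem: "1 \<in> F"
    and square_mem: "b \<in> F \<Longrightarrow> rd (b * b) y \<Longrightarrow> y \<in> F"
    and sqrt_square: "b \<in> F \<Longrightarrow> 0 < b \<Longrightarrow> rd (b * b) y \<Longrightarrow> rd (sqrt y) z \<Longrightarrow> z = b"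
begin

lemma B_dim [simp]: "dim_row B = p" "dim_col B = p"
  using B by auto

lemma W_dim [simp]: "dim_row W = n" "dim_col W = p"
  by (auto simp: W)

lemma B_mem: "j < p \<Longrightarrow> k < p \<Longrightarrow> B $$ (j, k) \<in> F"
  using B(2) elements_matI[OF B(1)] by blast

lemma B_lower: "k < j \<Longrightarrow> j < p \<Longrightarrow> B $$ (j, k) = 0"
  using upper_triangularD[OF B(3)] by simp

lemma signed_mem: "k < p \<Longrightarrow> x \<in> F \<Longrightarrow> s k * x \<in> F"
  using signed_unit_mult_mem[of "s k" x] sign[of k] by auto

lemma W_index: "j < p \<Longrightarrow> k < p \<Longrightarrow> W $$ (\<rho> j, k) = s j * B $$ (j, k)"
  unfolding W using mult_index[OF B(1)] .

lemma W_mem: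
  assumes "r < n" "k < p" shows "W $$ (r, k) \<in> F"
proof (cases "r \<in> \<rho> ` {..<p}")
  case True
  then show ?thesis using W_index B_mem signed_mem assms by auto
next
  case False
  then show ?thesis using mult_index_outside[OF B(1) assms(1) False assms(2), folded W] zero_mem by simp
qed

text \<open>Below the rows already treated only the diagonal entry of \<open>B\<close> is left, as \<open>B\<close> is upper
  triangular.\<close>

lemma W_remainder:
  assumes "r < n" "k < p" "r \<notin> \<rho> ` {..<k}"
  shows "W $$ (r, k) = (if r = \<rho> k then s k * B $$ (k, k) else 0)"
proof (cases "r \<in> \<rho> ` {..<p}")
  case True
  then obtain j where j: "j < p" "r = \<rho> j" by auto
  then have "k \<le> j" using assms(3) by (metis imageI lessThan_iff not_le)
  then show ?thesis using W_index j B_lower[of k j] assms(2) inj_eq[of j k] by (cases "j = k") auto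
next
  case False
  then show ?thesis using mult_index_outside[OF B(1) assms(1) False assms(2), folded W] assms(2) by auto
qed

context
  fixes Q S :: "real mat" and k :: nat and v :: "real vec"
  assumes Q: "Q \<in> carrier_mat n p" and k: "k < p"
    and Qj: "\<And>j r. j < k \<Longrightarrow> r < n \<Longrightarrow> Q $$ (r, j) = X $$ (r, j)"
begin

text \<open>Stated for any \<open>w\<close> that agrees with column \<open>k\<close> of \<open>W\<close> in the only row that column \<open>j\<close> of \<open>Q\<close>
  sees: for the modified variant, \<open>w\<close> is the current remainder instead of the original column.\<close>

lemma fl_inner_col:
  assumes i: "fl_inner rd (col Q j) w z" and w: "dim_vec w = n" "w $ \<rho> j = W $$ (\<rho> j, k)" and j: "j < k"
  shows "z = B $$ (j, k)"
proof -
  have jp: "j < p" using j k by simp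
  have c: "col Q j $ \<rho> j * w $ \<rho> j = B $$ (j, k)"
    using j jp k less[OF jp] Q Qj[OF j] w W_index[OF jp k] sign_square[OF jp] by (simp add: index)
  have "col Q j $ l * w $ l = 0" if "l < n" "l \<noteq> \<rho> j" for l
    using that j jp k Q Qj[OF j] by (simp add: index)
  then show ?thesis
    using fl_inner_single_nonzero[OF i, of "\<rho> j"] c w(1) less[OF jp] B_mem[OF jp k] by auto
qed

text \<open>Subtracting this vector clears row \<open>\<rho> j\<close> of the column and leaves the other rows untouched.\<close>

lemma rd_projection:
  assumes "rd (S $$ (j, k) * Q $$ (r, j)) y" "S $$ (j, k) = B $$ (j, k)" "j < k" "r < n"
  shows "y = (if r = \<rho> j then W $$ (r, k) else 0)"
proof -
  have jp: "j < p" using assms(3) k by simp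
  have "S $$ (j, k) * Q $$ (r, j) = (if r = \<rho> j then W $$ (r, k) else 0)"
    using assms jp Qj W_index[OF jp k] by (simp add: index mult.commute)
  moreover have "(if r = \<rho> j then W $$ (r, k) else 0) \<in> F"
    using W_mem[OF assms(4) k] zero_mem by (cases "r = \<rho> j") simp_all
  ultimately show ?thesis using exact[OF assms(1)] by simp
qed

text \<open>In row \<open>\<rho> j\<close> with \<open>j < k\<close>, the original entry is cancelled by the \<open>j\<close>-th projection, the others
  contribute zeros; all other rows are unaffected.\<close>

lemma gs_project_classical:
  assumes "gs_project rd Classical W Q S k v"
  shows "(\<forall>j < k. S $$ (j, k) = B $$ (j, k)) \<and> v \<in> carrier_vec n \<and>
    (\<forall>r < n. v $ r = (if r = \<rho> k then s k * B $$ (k, k) else 0))"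
proof (intro conjI allI impI)
  show S: "S $$ (j, k) = B $$ (j, k)" if "j < k" for j
    using assms fl_inner_col[of j "col W k"] that k less[of j] by simp
  show "v \<in> carrier_vec n" using assms by simp
  fix r assume r: "r < n"
  let ?w = "W $$ (r, k)"
  from assms r obtain y where y: "\<forall>j < k. rd (S $$ (j, k) * Q $$ (r, j)) (y j)"
    and sum: "fl_sum rd (add_mset ?w (image_mset (\<lambda>j. - y j) (mset_set {..<k}))) (v $ r)"
    by auto
  have yj: "y j = (if r = \<rho> j then ?w else 0)" if "j < k" for j
    using rd_projection S y that r by blast
  let ?Y = "image_mset (\<lambda>j. - y j) (mset_set {..<k})"
  have total: "sum_mset (add_mset ?w ?Y) = ?w + (\<Sum>j<k. - y j)"
    by (simp add: sum_unfold_sum_mset)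
  have vr: "v $ r = ?w + (\<Sum>j<k. - y j)"
    if "filter_mset (\<lambda>x. x \<noteq> 0) ?Y \<subseteq># {#- ?w#}"
  proof -
    have "filter_mset (\<lambda>x. x \<noteq> 0) (add_mset ?w ?Y) \<subseteq># {#?w, - ?w#}"
    proof (cases "?w = 0")
      case True
      then show ?thesis using that subset_mset.order_trans[OF that] by simp
    next
      case False
      then show ?thesis using that by simp
    qed
    from fl_sum_cancelling[OF sum this W_mem[OF r k]] show ?thesis unfolding total .
  qed
  show "v $ r = (if r = \<rho> k then s k * B $$ (k, k) else 0)"
  proof (cases "r \<in> \<rho> ` {..<k}")
    case True
    then obtain i where i: "i < k" "r = \<rho> i" by auto
    have others: "y j = 0" if "j < k" "j \<noteq> i" for j
      using yj[OF that(1)] that i k inj_eq[of i j] by auto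
    have "filter_mset (\<lambda>x. x \<noteq> 0) ?Y \<subseteq># {#- y i#}"
      using others i by (intro filter_nonzero_image_mset_le_single) auto
    then have "v $ r = ?w + (\<Sum>j<k. - y j)" using yj[OF i(1)] i(2) vr by simp
    also have "(\<Sum>j<k. - y j) = - y i"
      using others i by (subst sum.remove[of _ i]) auto
    finally have "v $ r = 0" using yj[OF i(1)] i(2) by simp
    moreover have "r \<noteq> \<rho> k" using i k inj_eq[of i k] by auto
    ultimately show ?thesis by simp
  next
    case False
    then have zero: "y j = 0" if "j < k" for j using yj[OF that] that by auto
    then have "filter_mset (\<lambda>x. x \<noteq> 0) ?Y = {#}"
      by (intro filter_nonzero_image_mset_empty) auto
    then have "v $ r = ?w + (\<Sum>j<k. - y j)" using vr by (simp only: empty_le)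
    then have "v $ r = ?w" using zero by simp
    then show ?thesis using W_remainder[OF r k False] by simp
  qed
qed

text \<open>After \<open>j\<close> steps the remainder is the original column with the rows \<open>\<rho> 0, ..., \<rho> (j - 1)\<close>
  replaced by zero.\<close>

lemma gs_project_modified:
  assumes "gs_project rd Modified W Q S k v"
  shows "(\<forall>j < k. S $$ (j, k) = B $$ (j, k)) \<and> v \<in> carrier_vec n \<and>
    (\<forall>r < n. v $ r = (if r = \<rho> k then s k * B $$ (k, k) else 0))"
proof -
  obtain w where w0: "w 0 = col W k" and wk: "w k = v"
    and w: "\<forall>j < k. fl_inner rd (col Q j) (w j) (S $$ (j, k)) \<and> w (Suc j) \<in> carrier_vec n \<and>
      (\<forall>r < n. \<exists>y. rd (S $$ (j, k) * Q $$ (r, j)) y \<and> rd (w j $ r - y) (w (Suc j) $ r))"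
    using assms unfolding gs_project.simps W_dim by blast
  have coeff: "fl_inner rd (col Q j) (w j) (S $$ (j, k))"
    and dim: "w (Suc j) \<in> carrier_vec n" if "j < k" for j
    using w[rule_format, OF that] by simp_all
  have step: "\<exists>y. rd (S $$ (j, k) * Q $$ (r, j)) y \<and> rd (w j $ r - y) (w (Suc j) $ r)"
    if "j < k" "r < n" for j r
    using w[rule_format, OF that(1), THEN conjunct2, THEN conjunct2, rule_format, OF that(2)] .
  have inv: "w j \<in> carrier_vec n \<and>
      (\<forall>r < n. w j $ r = (if r \<in> \<rho> ` {..<j} then 0 else W $$ (r, k))) \<and>
      (\<forall>i < j. S $$ (i, k) = B $$ (i, k))" if "j \<le> k" for j
    using that
  proof (induction j)
    case 0
    show ?case unfolding w0 using k carrier_vecI[of "col W k" n] by simp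
  next
    case (Suc j)
    then have j: "j < k" by simp
    have IH: "w j \<in> carrier_vec n"
        "\<And>r. r < n \<Longrightarrow> w j $ r = (if r \<in> \<rho> ` {..<j} then 0 else W $$ (r, k))"
        "\<And>i. i < j \<Longrightarrow> S $$ (i, k) = B $$ (i, k)"
      using Suc.IH j by simp_all
    have jp: "j < p" using j k by simp
    have new: "\<rho> j \<notin> \<rho> ` {..<j}"
    proof
      assume "\<rho> j \<in> \<rho> ` {..<j}"
      then obtain i where i: "i < j" "\<rho> j = \<rho> i" by blast
      then have "j = i" using inj_eq[of j i] jp by simp
      then show False using i by simp
    qed
    then have "w j $ \<rho> j = W $$ (\<rho> j, k)" using IH(2)[OF less[OF jp]] by simp
    then have S: "S $$ (j, k) = B $$ (j, k)"
      using fl_inner_col[OF coeff[OF j] _ _ j] IH(1) by simp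
    have "w (Suc j) $ r = (if r \<in> \<rho> ` {..<Suc j} then 0 else W $$ (r, k))" if r: "r < n" for r
    proof -
      obtain y where y: "rd (S $$ (j, k) * Q $$ (r, j)) y" "rd (w j $ r - y) (w (Suc j) $ r)"
        using step[OF j r] by blast
      have "y = (if r = \<rho> j then W $$ (r, k) else 0)" using rd_projection[OF y(1) S j r] .
      then have "w j $ r - y = (if r \<in> \<rho> ` {..<Suc j} then 0 else W $$ (r, k))"
        using IH(2)[OF r] new by (auto simp: lessThan_Suc)
      then show ?thesis using exact[OF y(2)] zero_mem W_mem[OF r k] by auto
    qed
    then show ?case using dim[OF j] IH(3) S by (auto simp: less_Suc_eq)
  qed
  have "v $ r = (if r = \<rho> k then s k * B $$ (k, k) else 0)" if r: "r < n" for r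
  proof (cases "r \<in> \<rho> ` {..<k}")
    case True
    then obtain i where i: "i < k" "r = \<rho> i" by blast
    then have "r \<noteq> \<rho> k" using inj_eq[of i k] k by simp
    then show ?thesis using inv[of k] wk True r by simp
  next
    case False
    then show ?thesis using inv[of k] wk r W_remainder[OF r k False] by simp
  qed
  then show ?thesis using inv[of k] wk by simp
qed

text \<open>The only place where an intermediate result, the rounded square, may be inexact.\<close>

lemma fl_norm_single_nonzero:
  assumes z: "fl_norm rd v z" and v: "v \<in> carrier_vec n"
    "\<And>r. r < n \<Longrightarrow> v $ r = (if r = \<rho> k then s k * B $$ (k, k) else 0)"
  shows "z = B $$ (k, k)"
proof -
  obtain x where x: "fl_inner rd v v x" "rd (sqrt x) z" using z unfolding fl_norm_def by blast
  obtain y where y: "\<And>l. l < n \<Longrightarrow> rd (v $ l * v $ l) (y l)"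
    and sum: "fl_sum rd (image_mset y (mset_set {..<n})) x"
    using x(1) carrier_vecD[OF v(1)] unfolding fl_inner_def by metis
  have "v $ \<rho> k * v $ \<rho> k = (s k * s k) * (B $$ (k, k) * B $$ (k, k))"
    using v(2)[OF less[OF k]] by simp
  then have yk: "rd (B $$ (k, k) * B $$ (k, k)) (y (\<rho> k))"
    using y[OF less[OF k]] sign_square[OF k] by simp
  have "y l = 0" if "l < n" "l \<noteq> \<rho> k" for l
    using exact[OF y[OF that(1)]] v(2)[OF that(1)] that zero_mem by simp
  then have "x = y (\<rho> k)"
    using fl_sum_single_nonzero[OF sum, of "\<rho> k"] square_mem[OF B_mem[OF k k] yk] less[OF k] by simp
  then show ?thesis using sqrt_square[OF B_mem[OF k k] diag[OF k] yk] x(2) by simp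
qed

end

text \<open>Column by column: once the first \<open>k\<close> columns of \<open>Q\<close> are known, the projection leaves
  \<open>s k * B\<^sub>k\<^sub>k\<close> in row \<open>\<rho> k\<close>, the norm is \<open>B\<^sub>k\<^sub>k\<close>, and the division yields the sign.\<close>

theorem gs_qr_exact:
  assumes qr: "gs_qr rd var W Q S"
  shows "Q = X" and "S = B"
proof -
  have Q: "Q \<in> carrier_mat n p" and S: "S \<in> carrier_mat p p" "upper_triangular S"
    using qr unfolding gs_qr_def by auto
  have cols: "(\<forall>r < n. Q $$ (r, k) = X $$ (r, k)) \<and> (\<forall>j \<le> k. S $$ (j, k) = B $$ (j, k))"
    if "k < p" for k
    using that
  proof (induction k rule: less_induct)
    case (less k)
    note k = \<open>k < p\<close>
    have Qj: "Q $$ (r, j) = X $$ (r, j)" if "j < k" "r < n" for j r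
      using less that by simp
    obtain v where v: "gs_project rd var W Q S k v" "fl_norm rd v (S $$ (k, k))"
      "\<And>r. r < n \<Longrightarrow> rd (v $ r / S $$ (k, k)) (Q $$ (r, k))"
      using qr k unfolding gs_qr_def by auto
    have proj: "\<And>j. j < k \<Longrightarrow> S $$ (j, k) = B $$ (j, k)" "v \<in> carrier_vec n"
      "\<And>r. r < n \<Longrightarrow> v $ r = (if r = \<rho> k then s k * B $$ (k, k) else 0)"
      using v(1) gs_project_classical[OF Q k Qj, of S v] gs_project_modified[OF Q k Qj, of S v]
      by (cases var; blast)+
    have Skk: "S $$ (k, k) = B $$ (k, k)"
      using fl_norm_single_nonzero[OF Q k Qj v(2) proj(2,3)] .
    have "Q $$ (r, k) = X $$ (r, k)" if r: "r < n" for r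
    proof -
      have "v $ r / S $$ (k, k) = X $$ (r, k)"
        unfolding proj(3)[OF r] Skk using diag[OF k] r k by (simp add: index)
      moreover have "X $$ (r, k) \<in> F"
        using r k signed_mem[OF k one_mem] zero_mem by (simp add: index)
      ultimately show ?thesis using exact[OF v(3)[OF r]] by simp
    qed
    then show ?case using proj(1) Skk by (auto simp: le_less)
  qed
  show "Q = X" using cols Q by (intro eq_matI) auto
  show "S = B"
  proof (rule eq_matI)
    fix i j assume "i < dim_row B" "j < dim_col B"
    then have ij: "i < p" "j < p" using B by auto
    show "S $$ (i, j) = B $$ (i, j)"
      using cols[OF ij(2)] B_lower[of j i] S ij by (cases "i \<le> j") auto
  qed (use S B in auto)
qed

end

section \<open>Uniqueness of the QR factorization\<close>

text \<open>Uniqueness of the Cholesky factor: row \<open>j\<close> of \<open>S\<^sup>T S\<close> is \<open>S\<^sub>j\<^sub>j\<close> times row \<open>j\<close> of \<open>S\<close>, up to terms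
  in the preceding rows of \<open>S\<close>.\<close>

lemma upper_triangular_gram_unique:
  fixes S S' :: "real mat"
  assumes S: "S \<in> carrier_mat p p" "upper_triangular S" "\<And>k. k < p \<Longrightarrow> 0 < S $$ (k, k)"
    and S': "S' \<in> carrier_mat p p" "upper_triangular S'" "\<And>k. k < p \<Longrightarrow> 0 < S' $$ (k, k)"
    and gram: "transpose_mat S * S = transpose_mat S' * S'"
  shows "S = S'"
proof -
  have entry: "(transpose_mat Y * Y) $$ (j, k) = (\<Sum>l<j. Y $$ (l, j) * Y $$ (l, k)) + Y $$ (j, j) * Y $$ (j, k)"
    if Y: "Y \<in> carrier_mat p p" "upper_triangular Y" and jk: "j < p" "k < p" for Y :: "real mat" and j k
  proof -
    have "(transpose_mat Y * Y) $$ (j, k) = (\<Sum>l<p. Y $$ (l, j) * Y $$ (l, k))"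
      using Y(1) jk by (simp add: scalar_prod_def atLeast0LessThan)
    also have "\<dots> = (\<Sum>l<Suc j. Y $$ (l, j) * Y $$ (l, k))"
      using upper_triangularD[OF Y(2)] Y(1) jk by (intro sum.mono_neutral_right) auto
    finally show ?thesis by simp
  qed
  have rows: "\<forall>k<p. S $$ (j, k) = S' $$ (j, k)" if "j < p" for j
    using that
  proof (induction j rule: less_induct)
    case (less j)
    have eq: "S $$ (j, j) * S $$ (j, k) = S' $$ (j, j) * S' $$ (j, k)" if k: "k < p" for k
    proof -
      have "(\<Sum>l<j. S $$ (l, j) * S $$ (l, k)) = (\<Sum>l<j. S' $$ (l, j) * S' $$ (l, k))"
        using less k by (intro sum.cong) auto
      moreover have "(transpose_mat S * S) $$ (j, k) = (transpose_mat S' * S') $$ (j, k)"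
        using gram by simp
      ultimately show ?thesis
        using entry[OF S(1,2) less.prems k] entry[OF S'(1,2) less.prems k] by linarith
    qed
    have "(S $$ (j, j))\<^sup>2 = (S' $$ (j, j))\<^sup>2"
      using eq[OF less.prems] by (simp add: power2_eq_square)
    then have d: "S $$ (j, j) = S' $$ (j, j)"
      using S(3)[OF less.prems] S'(3)[OF less.prems] by (simp add: power2_eq_iff_nonneg)
    show ?case
    proof (intro allI impI)
      fix k assume "k < p"
      then show "S $$ (j, k) = S' $$ (j, k)" using eq[of k] d S'(3)[OF less.prems] by simp
    qed
  qed
  show ?thesis
  proof (rule eq_matI)
    fix j k assume "j < dim_row S'" "k < dim_col S'"
    then show "S $$ (j, k) = S' $$ (j, k)" using rows[of j] S'(1) by simp
  qed (use S(1) S'(1) in simp_all)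
qed

text \<open>The triangular factor is the Cholesky factor of \<open>W\<^sup>T W\<close>; the columns of the orthonormal factor
  then follow by forward substitution.\<close>

lemma qr_factorization_unique:
  assumes QS: "qr_factorization W Q S" and QS': "qr_factorization W Q' S'"
  shows "Q = Q'" "S = S'"
proof -
  define n p where "n = dim_row W" and "p = dim_col W"
  have gram: "transpose_mat S * S = transpose_mat W * W" if "qr_factorization W Q S" for Q S
  proof -
    have c: "Q \<in> carrier_mat n p" "S \<in> carrier_mat p p"
      and o: "transpose_mat Q * Q = 1\<^sub>m p" and W: "W = Q * S"
      using that unfolding qr_factorization_def n_def p_def by blast+
    have "transpose_mat W * W = (transpose_mat S * transpose_mat Q) * (Q * S)"
      unfolding W using transpose_mult[OF c] by simp
    also have "\<dots> = transpose_mat S * (transpose_mat Q * (Q * S))"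
      using c by (intro assoc_mult_mat[of _ p p _ n _ p]) auto
    also have "transpose_mat Q * (Q * S) = (transpose_mat Q * Q) * S"
      using c by (intro assoc_mult_mat[of _ p n _ p _ p, symmetric]) auto
    finally show ?thesis using c by (simp add: o)
  qed
  have Q: "Q \<in> carrier_mat n p" "Q' \<in> carrier_mat n p" and W: "W = Q * S" "W = Q' * S'"
    and S: "S \<in> carrier_mat p p" "upper_triangular S" "\<And>k. k < p \<Longrightarrow> 0 < S $$ (k, k)"
    and S': "S' \<in> carrier_mat p p" "upper_triangular S'" "\<And>k. k < p \<Longrightarrow> 0 < S' $$ (k, k)"
    using QS QS' unfolding qr_factorization_def n_def p_def by blast+
  show "S = S'"
    by (rule upper_triangular_gram_unique[OF S S']) (simp_all add: gram[OF QS] gram[OF QS'])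
  note eq = this
  have entry: "(Y * S) $$ (r, k) = (\<Sum>l<k. Y $$ (r, l) * S $$ (l, k)) + Y $$ (r, k) * S $$ (k, k)"
    if Y: "Y \<in> carrier_mat n p" and rk: "r < n" "k < p" for Y r k
  proof -
    have "(Y * S) $$ (r, k) = (\<Sum>l<p. Y $$ (r, l) * S $$ (l, k))"
      using Y rk S(1) by (simp add: scalar_prod_def atLeast0LessThan)
    also have "\<dots> = (\<Sum>l<Suc k. Y $$ (r, l) * S $$ (l, k))"
      using upper_triangularD[OF S(2)] S(1) rk by (intro sum.mono_neutral_right) auto
    finally show ?thesis by simp
  qed
  have cols: "\<forall>r<n. Q $$ (r, k) = Q' $$ (r, k)" if "k < p" for k
    using that
  proof (induction k rule: less_induct)
    case (less k)
    show ?case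
    proof (intro allI impI)
      fix r assume r: "r < n"
      have "(\<Sum>l<k. Q $$ (r, l) * S $$ (l, k)) = (\<Sum>l<k. Q' $$ (r, l) * S $$ (l, k))"
        using less r by (intro sum.cong) auto
      moreover have "(Q * S) $$ (r, k) = (Q' * S) $$ (r, k)" using W eq by simp
      ultimately have "Q $$ (r, k) * S $$ (k, k) = Q' $$ (r, k) * S $$ (k, k)"
        using entry[OF Q(1) r less.prems] entry[OF Q(2) r less.prems] by linarith
      then show "Q $$ (r, k) = Q' $$ (r, k)" using S(3)[OF less.prems] by simp
    qed
  qed
  show "Q = Q'"
  proof (rule eq_matI)
    fix r k assume "r < dim_row Q'" "k < dim_col Q'"
    then show "Q $$ (r, k) = Q' $$ (r, k)" using cols[of k] Q(2) by simp
  qed (use Q in simp_all)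
qed

section \<open>Signed block permutation matrices\<close>

lemma div_mod_block:
  assumes "r < m * p" shows "r div p < m" "r mod p < (p::nat)"
proof -
  have "0 < p" using assms by (cases p) auto
  then show "r div p < m" "r mod p < p" using assms by (auto simp: less_mult_imp_div_less)
qed

lemma block_index_less: "i < m \<Longrightarrow> a < p \<Longrightarrow> i * p + a < m * (p::nat)"
proof -
  assume "i < m" "a < p"
  then have "i * p + a < (i + 1) * p" "i + 1 \<le> m" by simp_all
  then show ?thesis by (meson less_le_trans mult_le_mono1)
qed

lemma signed_block_permutation_matD:
  assumes "signed_block_permutation_mat m p P"
  shows "P \<in> carrier_mat (m * p) (m * p)"
    and "i < m \<Longrightarrow> \<exists>!j. j < m \<and> block_of p P i j \<noteq> 0\<^sub>m p p"
    and "j < m \<Longrightarrow> \<exists>!i. i < m \<and> block_of p P i j \<noteq> 0\<^sub>m p p"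
    and "i < m \<Longrightarrow> j < m \<Longrightarrow> block_of p P i j \<noteq> 0\<^sub>m p p \<Longrightarrow> signed_permutation_mat p (block_of p P i j)"
proof -
  note P = assms[unfolded signed_block_permutation_mat_def]
  show "P \<in> carrier_mat (m * p) (m * p)" by (rule P[THEN conjunct1])
  show "i < m \<Longrightarrow> \<exists>!j. j < m \<and> block_of p P i j \<noteq> 0\<^sub>m p p"
    by (rule P[THEN conjunct2, THEN conjunct1, rule_format])
  show "j < m \<Longrightarrow> \<exists>!i. i < m \<and> block_of p P i j \<noteq> 0\<^sub>m p p"
    by (rule P[THEN conjunct2, THEN conjunct2, THEN conjunct1, rule_format])
  show "i < m \<Longrightarrow> j < m \<Longrightarrow> block_of p P i j \<noteq> 0\<^sub>m p p \<Longrightarrow> signed_permutation_mat p (block_of p P i j)"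
    by (rule P[THEN conjunct2, THEN conjunct2, THEN conjunct2, rule_format])
qed

lemma signed_block_permutation_columns:
  assumes P: "signed_block_permutation_mat m p P" and c: "c < m * p"
  obtains r where "r < m * p" "P $$ (r, c) \<in> {1, - 1}"
    "\<And>r'. r' < m * p \<Longrightarrow> r' \<noteq> r \<Longrightarrow> P $$ (r', c) = 0"
proof -
  have jb: "c div p < m" "c mod p < p" using div_mod_block[OF c] .
  have entry: "P $$ (r, c) = block_of p P (r div p) (c div p) $$ (r mod p, c mod p)"
    if "r < m * p" for r
    using div_mod_block[OF that] jb by (simp add: block_of_def)
  obtain i where i: "i < m" "block_of p P i (c div p) \<noteq> 0\<^sub>m p p"
    and uniq: "\<And>i'. i' < m \<Longrightarrow> i' \<noteq> i \<Longrightarrow> block_of p P i' (c div p) = 0\<^sub>m p p"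
    using signed_block_permutation_matD(3)[OF P jb(1)] by blast
  obtain \<pi> t where \<pi>: "\<pi> permutes {..<p}" and t: "\<forall>i<p. t i = 1 \<or> t i = -1"
    and X: "block_of p P i (c div p) = mat p p (\<lambda>(i, j). if j = \<pi> i then t i else 0)"
    using signed_block_permutation_matD(4)[OF P i(1) jb(1) i(2)]
    unfolding signed_permutation_mat_def by blast
  obtain a where a: "a < p" "\<pi> a = c mod p"
    using permutes_image[OF \<pi>] jb(2) by (metis imageE lessThan_iff)
  show thesis
  proof (rule that[of "i * p + a"])
    show r: "i * p + a < m * p" using block_index_less[OF i(1) a(1)] .
    have "P $$ (i * p + a, c) = t a" using entry[OF r] a jb by (simp add: X)
    then show "P $$ (i * p + a, c) \<in> {1, - 1}" using t a by auto
    fix r' assume r': "r' < m * p" "r' \<noteq> i * p + a"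
    show "P $$ (r', c) = 0"
    proof (cases "r' div p = i")
      case True
      then have "r' mod p \<noteq> a" using r'(2) by (metis div_mult_mod_eq)
      then have "\<pi> (r' mod p) \<noteq> c mod p" using a permutes_inj[OF \<pi>] by (metis injD)
      then show ?thesis using entry[OF r'(1)] True div_mod_block[OF r'(1)] jb by (simp add: X)
    next
      case False
      then show ?thesis using entry[OF r'(1)] uniq div_mod_block[OF r'(1)] jb by simp
    qed
  qed
qed

lemma signed_block_permutation_rows:
  assumes P: "signed_block_permutation_mat m p P" and r: "r < m * p" and c: "c < m * p" "c' < m * p"
    and nz: "P $$ (r, c) \<noteq> 0" "P $$ (r, c') \<noteq> 0"
  shows "c = c'"
proof -
  have ia: "r div p < m" "r mod p < p" using div_mod_block[OF r] .
  have entry: "P $$ (r, d) = block_of p P (r div p) (d div p) $$ (r mod p, d mod p)"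
    if "d < m * p" for d
    using div_mod_block[OF that] ia by (simp add: block_of_def)
  have block: "block_of p P (r div p) (d div p) \<noteq> 0\<^sub>m p p" if "d < m * p" "P $$ (r, d) \<noteq> 0" for d
    using entry[OF that(1)] that(2) div_mod_block[OF that(1)] ia by auto
  have j: "c div p = c' div p"
    using signed_block_permutation_matD(2)[OF P ia(1)] block[OF c(1) nz(1)] block[OF c(2) nz(2)] div_mod_block(1)[OF c(1)] div_mod_block(1)[OF c(2)]
    by blast
  obtain \<pi> t where
    X: "block_of p P (r div p) (c div p) = mat p p (\<lambda>(i, j). if j = \<pi> i then t i else 0)"
    using signed_block_permutation_matD(4)[OF P ia(1) div_mod_block(1)[OF c(1)] block[OF c(1) nz(1)]]
    unfolding signed_permutation_mat_def by blast
  have "c mod p = \<pi> (r mod p)"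
    using entry[OF c(1)] nz(1) ia div_mod_block(2)[OF c(1)] by (auto simp: X split: if_splits)
  moreover have "c' mod p = \<pi> (r mod p)"
    using entry[OF c(2)] nz(2) ia div_mod_block(2)[OF c(2)]
    by (auto simp: X simp flip: j split: if_splits)
  ultimately show ?thesis using j by (metis div_mult_mod_eq)
qed

text \<open>\<open>\<rho>\<close> is injective because a block row has only one nonzero block, and a row of that block only one
  nonzero entry.\<close>

lemma signed_block_permutation_selection:
  assumes P: "signed_block_permutation_mat m p P"
  obtains \<rho> s where "selection (m * p) (m * p) \<rho> s" "P = signed_selection (m * p) (m * p) \<rho> s"
proof -
  have "\<forall>c. \<exists>r. c < m * p \<longrightarrow> r < m * p \<and> P $$ (r, c) \<in> {1, - 1} \<and>
      (\<forall>r' < m * p. r' \<noteq> r \<longrightarrow> P $$ (r', c) = 0)"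
    using signed_block_permutation_columns[OF P] by metis
  then obtain \<rho> where "\<forall>c. c < m * p \<longrightarrow> \<rho> c < m * p \<and> P $$ (\<rho> c, c) \<in> {1, - 1} \<and>
      (\<forall>r' < m * p. r' \<noteq> \<rho> c \<longrightarrow> P $$ (r', c) = 0)"
    by metis
  then have \<rho>: "\<rho> c < m * p" "P $$ (\<rho> c, c) \<in> {1, - 1}"
      "\<And>r'. r' < m * p \<Longrightarrow> r' \<noteq> \<rho> c \<Longrightarrow> P $$ (r', c) = 0" if "c < m * p" for c
    using that by blast+
  show thesis
  proof (rule that[of \<rho> "\<lambda>c. P $$ (\<rho> c, c)"])
    show "selection (m * p) (m * p) \<rho> (\<lambda>c. P $$ (\<rho> c, c))"
    proof
      show "inj_on \<rho> {..<m * p}"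
      proof (rule inj_onI)
        fix c c' assume *: "c \<in> {..<m * p}" "c' \<in> {..<m * p}" "\<rho> c = \<rho> c'"
        have "P $$ (\<rho> c, c) \<noteq> 0" "P $$ (\<rho> c, c') \<noteq> 0"
          using \<rho>(2)[of c] \<rho>(2)[of c'] * by auto
        then show "c = c'" using signed_block_permutation_rows[OF P \<rho>(1)[of c], of c c'] * by simp
      qed
    qed (use \<rho> in auto)
    have "P \<in> carrier_mat (m * p) (m * p)" by (rule signed_block_permutation_matD(1)[OF P])
    then show "P = signed_selection (m * p) (m * p) \<rho> (\<lambda>c. P $$ (\<rho> c, c))"
      unfolding signed_selection_def using \<rho>(3) by (intro eq_matI) auto
  qed
qed

section \<open>The Lanczos recurrence in exact arithmetic\<close>

locale lanczos_input = P: selection "m * p" "m * p" \<rho> s for m p \<rho> s +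
  fixes Mt Bt :: "nat \<Rightarrow> real mat"
  assumes m_pos: "0 < m" and p_pos: "0 < p"
    and Mt: "i \<in> {1..m} \<Longrightarrow> Mt i \<in> carrier_mat p p" "i \<in> {1..m} \<Longrightarrow> transpose_mat (Mt i) = Mt i"
    and Bt: "i \<in> {2..m} \<Longrightarrow> Bt i \<in> carrier_mat p p" "i \<in> {2..m} \<Longrightarrow> upper_triangular (Bt i)"
      "i \<in> {2..m} \<Longrightarrow> k < p \<Longrightarrow> 0 < Bt i $$ (k, k)"
begin

abbreviation n where "n \<equiv> m * p"

abbreviation T where "T \<equiv> block_tridiagonal p m Mt Bt"

definition A where "A = P.X * T * transpose_mat P.X"

text \<open>Block columns \<open>1, 2, ...\<close> of the identity and of \<open>P\<close>.  The truncated subtraction makes index \<open>0\<close>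
  coincide with index \<open>1\<close>, as the convention \<open>U\<^sub>0 = U\<^sub>1\<close> of the algorithm demands.\<close>

definition E where "E i = signed_selection n p (\<lambda>k. (i - 1) * p + k) (\<lambda>k. 1)"

definition V where
  "V i = signed_selection n p (\<lambda>k. \<rho> ((i - 1) * p + k)) (\<lambda>k. s ((i - 1) * p + k))"

text \<open>The subdiagonal blocks, completed by the initial value of the algorithm.\<close>

definition B0 where "B0 i = (if i = 1 then 0\<^sub>m p p else Bt i)"

lemma n_pos: "0 < n"
  using m_pos p_pos by simp

lemma block_row_less: "i \<le> m \<Longrightarrow> k < p \<Longrightarrow> (i - 1) * p + k < n"
  using block_index_less[of "i - 1" m k p] m_pos by (cases i) simp_all

lemma selection_E: "i \<le> m \<Longrightarrow> selection n p (\<lambda>k. (i - 1) * p + k) (\<lambda>k. 1)"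
  using block_row_less by unfold_locales (auto simp: inj_on_def)

lemma selection_V: "i \<le> m \<Longrightarrow> selection n p (\<lambda>k. \<rho> ((i - 1) * p + k)) (\<lambda>k. s ((i - 1) * p + k))"
  using block_row_less[of i] P.less P.sign P.inj_eq by unfold_locales (simp_all add: inj_on_def)

lemma E_carrier: "E i \<in> carrier_mat n p"
  by (simp add: E_def signed_selection_def)

lemma V_carrier: "V i \<in> carrier_mat n p"
  by (simp add: V_def signed_selection_def)

lemma T_carrier: "T \<in> carrier_mat n n"
  by (simp add: block_tridiagonal_def)

lemma A_carrier: "A \<in> carrier_mat n n"
  unfolding A_def using T_carrier P.carrier(1) by (intro mult_carrier_mat[of _ n n _ n]) simp_all

lemma B0_carrier: "i \<in> {1..m} \<Longrightarrow> B0 i \<in> carrier_mat p p"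
  using Bt(1)[of i] by (simp add: B0_def)

lemma row_cases:
  assumes "r < n" obtains d where "d < n" "r = \<rho> d"
proof -
  have "\<rho> ` {..<n} = {..<n}"
    using P.inj P.less by (intro endo_inj_surj) auto
  then show thesis using assms that by blast
qed

lemma V_eq: "i \<le> m \<Longrightarrow> V i = P.X * E i"
proof (rule eq_matI)
  fix r c assume i: "i \<le> m" and "r < dim_row (P.X * E i)" "c < dim_col (P.X * E i)"
  then have rc: "r < n" "c < p" using carrier_matD[OF E_carrier] by auto
  obtain d where d: "d < n" "r = \<rho> d" using row_cases[OF rc(1)] .
  have "(P.X * E i) $$ (\<rho> d, c) = s d * E i $$ (d, c)"
    using P.mult_index[OF E_carrier d(1) rc(2)] .
  also have "\<dots> = V i $$ (\<rho> d, c)"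
    using d rc P.less[OF d(1)] P.inj_eq[OF d(1) block_row_less[OF i rc(2)]]
    by (simp add: E_def V_def signed_selection_def)
  finally show "V i $$ (r, c) = (P.X * E i) $$ (r, c)" using d by simp
qed (simp_all add: carrier_matD[OF E_carrier] carrier_matD[OF V_carrier])

lemma V_0: "V 0 = V 1"
  by (simp add: V_def)

lemma V_1: "V 1 = P.X * first_block_column m p"
proof -
  have "first_block_column m p = E 1"
    by (simp add: first_block_column_def E_def signed_selection_def)
  then show ?thesis using V_eq[of 1] m_pos by simp
qed

lemma E_mult_index:
  assumes i: "i \<in> {1..m}" and K: "K \<in> carrier_mat p p" and d: "d < n" and c: "c < p"
  shows "(E i * K) $$ (d, c) = (if d div p + 1 = i then K $$ (d mod p, c) else 0)"
proof (cases "d div p + 1 = i")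
  case True
  interpret E: selection n p "\<lambda>k. (i - 1) * p + k" "\<lambda>k. 1" using selection_E[of i] i by simp
  have "d = (i - 1) * p + d mod p" using True div_mult_mod_eq[of d p] by auto
  then show ?thesis
    using E.mult_index[OF K div_mod_block(2)[OF d] c] True by (simp add: E_def)
next
  case False
  interpret E: selection n p "\<lambda>k. (i - 1) * p + k" "\<lambda>k. 1" using selection_E[of i] i by simp
  have "d \<notin> (\<lambda>k. (i - 1) * p + k) ` {..<p}"
  proof
    assume "d \<in> (\<lambda>k. (i - 1) * p + k) ` {..<p}"
    then obtain k where "k < p" "d = (i - 1) * p + k" by blast
    then have "d div p = i - 1" by simp
    then show False using False i by simp
  qed
  then show ?thesis using E.mult_index_outside[OF K d _ c] False by (simp add: E_def)
qed

text \<open>Block column \<open>i\<close> of \<open>T\<close>.  The block row of \<open>d\<close>, counted from one, is \<open>d div p + 1\<close>.\<close>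

lemma T_index:
  assumes i: "i \<in> {1..m}" and d: "d < n" and c: "c < p"
  shows "T $$ (d, (i - 1) * p + c) =
    (if d div p + 1 = i then Mt i $$ (d mod p, c)
     else if d div p = i then Bt (i + 1) $$ (d mod p, c)
     else if d div p + 2 = i then transpose_mat (Bt i) $$ (d mod p, c)
     else 0)"
proof -
  have "(i - 1) * p + c < n" using block_row_less i c by simp
  moreover have "((i - 1) * p + c) div p = i - 1" "((i - 1) * p + c) mod p = c" using c by simp_all
  moreover have "i - 1 + 1 = i" using i by simp
  ultimately show ?thesis using d
    by (auto simp: block_tridiagonal_def Let_def)
qed

lemma T_symmetric: "transpose_mat T = T"
proof (rule eq_matI)
  fix r c assume "r < dim_row T" "c < dim_col T"
  then have rc: "r < n" "c < n" by (simp_all add: block_tridiagonal_def)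
  have r: "r div p < m" "r mod p < p" and c: "c div p < m" "c mod p < p"
    using div_mod_block[OF rc(1)] div_mod_block[OF rc(2)] by simp_all
  have M: "Mt (Suc (r div p)) $$ (c mod p, r mod p) = Mt (Suc (r div p)) $$ (r mod p, c mod p)"
  proof -
    have i: "Suc (r div p) \<in> {1..m}" using r by simp
    have "transpose_mat (Mt (Suc (r div p))) $$ (r mod p, c mod p) = Mt (Suc (r div p)) $$ (c mod p, r mod p)"
      using Mt(1)[OF i] r c by simp
    then show ?thesis using Mt(2)[OF i] by simp
  qed
  have Btr: "transpose_mat (Bt (Suc i)) $$ (a, b) = Bt (Suc i) $$ (b, a)"
    if "0 < i" "i < m" "a < p" "b < p" for i a b
    using Bt(1)[of "Suc i"] that by simp
  show "transpose_mat T $$ (r, c) = T $$ (r, c)"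
  proof (cases "c div p = Suc (r div p)")
    case True
    then show ?thesis using rc Btr[of "c div p" "r mod p" "c mod p"] r c
      by (simp add: block_tridiagonal_def Let_def)
  next
    case False
    then show ?thesis using rc Btr[of "r div p" "c mod p" "r mod p"] r c M
      by (cases "r div p = Suc (c div p)"; cases "r div p = c div p")
        (simp_all add: block_tridiagonal_def Let_def)
  qed
qed (simp_all add: block_tridiagonal_def)

lemma A_symmetric: "transpose_mat A = A"
proof -
  have "transpose_mat A = transpose_mat (transpose_mat P.X) * transpose_mat (P.X * T)"
    unfolding A_def
    using transpose_mult[OF mult_carrier_mat[OF P.carrier(1) T_carrier], of "transpose_mat P.X" n] by simp
  also have "transpose_mat (P.X * T) = transpose_mat T * transpose_mat P.X"
    using transpose_mult[OF P.carrier(1) T_carrier] .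
  also have "transpose_mat (transpose_mat P.X) * (transpose_mat T * transpose_mat P.X) = A"
    unfolding T_symmetric A_def transpose_transpose
    using T_carrier P.carrier(1) by (intro assoc_mult_mat[of _ n n _ n _ n, symmetric]) simp_all
  finally show ?thesis .
qed

text \<open>The factor \<open>P\<close> in \<open>V\<^sub>i\<close> cancels against the trailing \<open>P\<^sup>T\<close> of \<open>A\<close>, so that \<open>A V\<^sub>i\<close> is block
  column \<open>i\<close> of \<open>T\<close> with rows permuted and signed.\<close>

lemma AV_eq: "i \<le> m \<Longrightarrow> A * V i = P.X * (T * E i)"
proof -
  assume i: "i \<le> m"
  have PT: "P.X * T \<in> carrier_mat n n" using T_carrier P.carrier(1) by (rule mult_carrier_mat[rotated])
  have "A * V i = P.X * T * (transpose_mat P.X * (P.X * E i))"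
    unfolding A_def V_eq[OF i] using PT mult_carrier_mat[OF P.carrier(1) E_carrier[of i]]
    by (intro assoc_mult_mat[of _ n n _ n _ p]) simp_all
  also have "transpose_mat P.X * (P.X * E i) = transpose_mat P.X * P.X * E i"
    using E_carrier P.carrier(1) by (intro assoc_mult_mat[of _ n n _ n _ p, symmetric]) simp_all
  also have "\<dots> = E i" unfolding P.orthonormal using E_carrier by (rule left_mult_one_mat)
  also have "P.X * T * E i = P.X * (T * E i)"
    using E_carrier T_carrier P.carrier(1) by (intro assoc_mult_mat[of _ n n _ n _ p]) simp_all
  finally show ?thesis .
qed

lemma AV_index:
  assumes i: "i \<in> {1..m}" and d: "d < n" and c: "c < p"
  shows "(A * V i) $$ (\<rho> d, c) = s d * T $$ (d, (i - 1) * p + c)"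
proof -
  interpret E: selection n p "\<lambda>k. (i - 1) * p + k" "\<lambda>k. 1" using selection_E[of i] i by simp
  have "(A * V i) $$ (\<rho> d, c) = s d * (T * E i) $$ (d, c)"
    using P.mult_index[OF mult_carrier_mat[OF T_carrier E_carrier] d c] AV_eq[of i] i by simp
  also have "(T * E i) $$ (d, c) = T $$ (d, (i - 1) * p + c)"
    using E.mult_right_index[OF T_carrier d c] by (simp add: E_def)
  finally show ?thesis .
qed

lemma V_mult_index:
  assumes i: "i \<in> {1..m}" and K: "K \<in> carrier_mat p p" and d: "d < n" and c: "c < p"
  shows "(V i * K) $$ (\<rho> d, c) = s d * (if d div p + 1 = i then K $$ (d mod p, c) else 0)"
proof -
  have "V i * K = P.X * (E i * K)"
    using V_eq[of i] i assoc_mult_mat[OF P.carrier(1) E_carrier K] by simp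
  then show ?thesis
    using P.mult_index[OF mult_carrier_mat[OF E_carrier K] d c] E_mult_index[OF i K d c] by simp
qed

text \<open>The nonzero blocks in a block column of \<open>T\<close> occupy distinct block rows, so each entry of \<open>A V\<^sub>i\<close> reappears in exactly one of the other
  three terms of the recurrence, or is zero.  This is stronger than the recurrence: it also shows
  that the floating point subtractions either do nothing or cancel completely.\<close>

lemma recurrence_terms:
  assumes i: "i \<in> {1..<m}" and d: "d < n" and c: "c < p"
  shows "(V i * Mt i) $$ (\<rho> d, c) = (if d div p + 1 = i then (A * V i) $$ (\<rho> d, c) else 0)"
    and "(V (i - 1) * transpose_mat (B0 i)) $$ (\<rho> d, c) =
      (if d div p + 2 = i then (A * V i) $$ (\<rho> d, c) else 0)"
    and "(V (i + 1) * Bt (i + 1)) $$ (\<rho> d, c) =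
      (if d div p = i then (A * V i) $$ (\<rho> d, c) else 0)"
    and "d div p + 1 \<noteq> i \<Longrightarrow> d div p + 2 \<noteq> i \<Longrightarrow> d div p \<noteq> i \<Longrightarrow> (A * V i) $$ (\<rho> d, c) = 0"
proof -
  have i': "i \<in> {1..m}" "i + 1 \<in> {1..m}" "i + 1 \<in> {2..m}" using i by auto
  note AV = AV_index[OF i'(1) d c] T_index[OF i'(1) d c]
  show "(V i * Mt i) $$ (\<rho> d, c) = (if d div p + 1 = i then (A * V i) $$ (\<rho> d, c) else 0)"
    using V_mult_index[OF i'(1) Mt(1)[OF i'(1)] d c] AV by simp
  show "(V (i + 1) * Bt (i + 1)) $$ (\<rho> d, c) =
      (if d div p = i then (A * V i) $$ (\<rho> d, c) else 0)"
    using V_mult_index[OF i'(2) Bt(1)[OF i'(3)] d c] AV by simp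
  show "(A * V i) $$ (\<rho> d, c) = 0"
    if "d div p + 1 \<noteq> i" "d div p + 2 \<noteq> i" "d div p \<noteq> i"
    using AV that by simp
  show "(V (i - 1) * transpose_mat (B0 i)) $$ (\<rho> d, c) =
      (if d div p + 2 = i then (A * V i) $$ (\<rho> d, c) else 0)"
  \<comment> \<open>here \<open>V\<^sub>0 = V\<^sub>1\<close> is not the block column before \<open>V\<^sub>1\<close>, but it is multiplied by zero\<close>
  proof (cases "i = 1")
    case True
    have "V (i - 1) * transpose_mat (B0 i) = 0\<^sub>m n p"
      using True V_carrier[of 0] by (simp add: B0_def)
    then show ?thesis using True P.less[OF d] c by simp
  next
    case False
    then have i2: "i - 1 \<in> {1..m}" "i \<in> {2..m}" using i by auto
    have eq: "d div p + 1 = i - 1 \<longleftrightarrow> d div p + 2 = i" using False i by auto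
    have "transpose_mat (Bt i) \<in> carrier_mat p p" using Bt(1)[OF i2(2)] by simp
    from V_mult_index[OF i2(1) this d c] show ?thesis
      using AV False unfolding eq by (simp add: B0_def)
  qed
qed

lemma recurrence:
  assumes i: "i \<in> {1..<m}"
  shows "A * V i - V i * Mt i - V (i - 1) * transpose_mat (B0 i) = V (i + 1) * Bt (i + 1)"
proof -
  have i': "i \<in> {1..m}" "i + 1 \<in> {2..m}" using i by auto
  have car: "A * V i \<in> carrier_mat n p" "V i * Mt i \<in> carrier_mat n p"
    "V (i - 1) * transpose_mat (B0 i) \<in> carrier_mat n p" "V (i + 1) * Bt (i + 1) \<in> carrier_mat n p"
    using mult_carrier_mat[OF A_carrier V_carrier] mult_carrier_mat[OF V_carrier Mt(1)[OF i'(1)]]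
      mult_carrier_mat[OF V_carrier transpose_carrier_mat[THEN iffD2, OF B0_carrier[OF i'(1)]]]
      mult_carrier_mat[OF V_carrier Bt(1)[OF i'(2)]] by blast+
  note dims = carrier_matD[OF car(1)] carrier_matD[OF car(2)] carrier_matD[OF car(3)] carrier_matD[OF car(4)]
  show ?thesis
  proof (rule eq_matI)
    fix r c assume "r < dim_row (V (i + 1) * Bt (i + 1))" "c < dim_col (V (i + 1) * Bt (i + 1))"
    then have rc: "r < n" "c < p" unfolding dims by simp_all
    obtain d where d: "d < n" "r = \<rho> d" using row_cases[OF rc(1)] .
    have "(A * V i - V i * Mt i - V (i - 1) * transpose_mat (B0 i)) $$ (r, c) =
        (A * V i) $$ (r, c) - (V i * Mt i) $$ (r, c) - (V (i - 1) * transpose_mat (B0 i)) $$ (r, c)"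
      using rc dims by (simp del: index_mult_mat)
    also have "\<dots> = (V (i + 1) * Bt (i + 1)) $$ (r, c)"
      unfolding d(2) recurrence_terms(1-3)[OF i d(1) rc(2)]
      using recurrence_terms(4)[OF i d(1) rc(2)] by (simp del: index_mult_mat)
    finally show "(A * V i - V i * Mt i - V (i - 1) * transpose_mat (B0 i)) $$ (r, c) =
        (V (i + 1) * Bt (i + 1)) $$ (r, c)" .
  qed (simp_all only: index_minus_mat dims)
qed

lemma diagonal_block:
  assumes i: "i \<in> {1..m}"
  shows "transpose_mat (V i) * A * V i = Mt i"
proof -
  interpret V: selection n p "\<lambda>k. \<rho> ((i - 1) * p + k)" "\<lambda>k. s ((i - 1) * p + k)"
    using selection_V[of i] i by simp
  have "transpose_mat (V i) * A * V i = transpose_mat (V i) * (A * V i)"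
    using A_carrier V_carrier[of i] by (intro assoc_mult_mat[of _ p n _ n _ p]) simp_all
  also have "\<dots> = Mt i"
  proof (rule eq_matI)
    fix k c assume "k < dim_row (Mt i)" "c < dim_col (Mt i)"
    then have kc: "k < p" "c < p" using Mt(1)[OF i] by simp_all
    have d: "(i - 1) * p + k < n" using block_row_less[of i k] kc i by simp
    have "(transpose_mat (V i) * (A * V i)) $$ (k, c) =
        s ((i - 1) * p + k) * (A * V i) $$ (\<rho> ((i - 1) * p + k), c)"
      using V.transpose_mult_index[OF mult_carrier_mat[OF A_carrier V_carrier[of i]] kc]
      by (simp only: V_def)
    also have "\<dots> = T $$ ((i - 1) * p + k, (i - 1) * p + c)"
      unfolding AV_index[OF i d kc(2)] mult.assoc[symmetric] P.sign_square[OF d] by simp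
    also have "\<dots> = Mt i $$ (k, c)"
      unfolding T_index[OF i d kc(2)] using kc i by simp
    finally show "(transpose_mat (V i) * (A * V i)) $$ (k, c) = Mt i $$ (k, c)" .
  qed (use Mt(1)[OF i] V_carrier[of i] in simp_all)
  finally show ?thesis .
qed

lemma V_orthonormal: "i \<le> m \<Longrightarrow> transpose_mat (V i) * V i = 1\<^sub>m p"
  unfolding V_def using selection.orthonormal[OF selection_V] .

lemma qr_factorization_V:
  assumes i: "i \<in> {1..<m}"
  shows "qr_factorization (V (i + 1) * Bt (i + 1)) (V (i + 1)) (Bt (i + 1))"
proof -
  have "i + 1 \<in> {2..m}" "i + 1 \<le> m" using i by auto
  then show ?thesis unfolding qr_factorization_def
    using Bt[of "i + 1"] V_carrier[of "i + 1"] V_orthonormal[of "i + 1"] by simp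
qed

lemma block_lanczos_run: "block_lanczos p m A (V 1) V (\<lambda>i. V i * Bt i) Mt B0"
  unfolding block_lanczos_def
proof (intro conjI ballI)
  show "square_mat A" using A_carrier by simp
  show "V 1 \<in> carrier_mat (dim_row A) p" using A_carrier V_carrier[of 1] by simp
  show "transpose_mat (V 1) * V 1 = 1\<^sub>m p" using V_orthonormal[of 1] m_pos by simp
  show "Mt 1 = transpose_mat (V 1) * A * V 1" using diagonal_block[of 1] m_pos by simp
  show "V 0 = V 1" by (rule V_0)
  fix i assume i: "i \<in> {1..<m}"
  show "V (i + 1) * Bt (i + 1) = A * V i - V i * Mt i - V (i - 1) * transpose_mat (B0 i)"
    using recurrence[OF i] by simp
  show "qr_factorization (V (i + 1) * Bt (i + 1)) (V (i + 1)) (B0 (i + 1))"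
    using qr_factorization_V[OF i] i by (simp add: B0_def)
  show "Mt (i + 1) = transpose_mat (V (i + 1)) * A * V (i + 1)"
    using diagonal_block[of "i + 1"] i by simp
qed (simp_all add: A_symmetric B0_def)

text \<open>The common description of exact and floating point runs by which they are compared.\<close>

definition expected_run where
  "expected_run U R M B \<longleftrightarrow> (\<forall>i \<in> {0..m}. U i = V i) \<and> (\<forall>i \<in> {2..m}. R i = V i * Bt i) \<and>
     (\<forall>i \<in> {1..m}. M i = Mt i) \<and> (\<forall>i \<in> {1..m}. B i = B0 i)"

text \<open>The recurrence reaches back two steps, hence the invariant of the induction covers \<open>U\<^sub>i\<close> and
  \<open>U\<^sub>i\<^sub>-\<^sub>1\<close>.\<close>

lemma expected_runI:
  assumes U: "U 0 = V 1" "U 1 = V 1" and M: "M 1 = Mt 1" and B: "B 1 = 0\<^sub>m p p"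
    and step: "\<And>i. i \<in> {1..<m} \<Longrightarrow> U i = V i \<Longrightarrow> U (i - 1) = V (i - 1) \<Longrightarrow> M i = Mt i \<Longrightarrow> B i = B0 i \<Longrightarrow>
      R (i + 1) = V (i + 1) * Bt (i + 1) \<and> U (i + 1) = V (i + 1) \<and> B (i + 1) = Bt (i + 1) \<and>
      M (i + 1) = Mt (i + 1)"
  shows "expected_run U R M B"
proof -
  have inv: "U i = V i \<and> U (i - 1) = V (i - 1) \<and> M i = Mt i \<and> B i = B0 i \<and>
      (2 \<le> i \<longrightarrow> R i = V i * Bt i)" if "1 \<le> i" "i \<le> m" for i
    using that
  proof (induction i rule: nat_induct_at_least)
    case base
    show ?case using U M B by (simp add: V_0 B0_def)
  next
    case (Suc i)
    then have "i \<in> {1..<m}" and IH: "U i = V i" "U (i - 1) = V (i - 1)" "M i = Mt i" "B i = B0 i" by simp_all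
    from step[OF this] IH(1) Suc.hyps show ?case by (simp add: B0_def)
  qed
  show ?thesis unfolding expected_run_def
  proof (intro conjI ballI)
    show "U i = V i" if "i \<in> {0..m}" for i
      using inv[of i] that U by (cases "i = 0") (simp_all add: V_0)
  qed (use inv in simp_all)
qed

lemma block_lanczos_unique:
  assumes run: "block_lanczos p m A (V 1) U R M B"
  shows "expected_run U R M B"
proof (rule expected_runI)
  note run = run[unfolded block_lanczos_def]
  show U: "U 0 = V 1" "U 1 = V 1" "B 1 = 0\<^sub>m p p" using run by blast+
  have "M 1 = transpose_mat (U 1) * A * U 1" using run by blast
  then show "M 1 = Mt 1" using U(2) diagonal_block[of 1] m_pos by simp
  fix i assume i: "i \<in> {1..<m}" and IH: "U i = V i" "U (i - 1) = V (i - 1)" "M i = Mt i" "B i = B0 i"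
  have step: "R (i + 1) = A * U i - U i * M i - U (i - 1) * transpose_mat (B i)"
    "qr_factorization (R (i + 1)) (U (i + 1)) (B (i + 1))"
    "M (i + 1) = transpose_mat (U (i + 1)) * A * U (i + 1)" using run i by blast+
  have R: "R (i + 1) = V (i + 1) * Bt (i + 1)" using step(1) recurrence[OF i] unfolding IH by simp
  have "U (i + 1) = V (i + 1)" "B (i + 1) = Bt (i + 1)"
    using qr_factorization_unique[OF step(2)[unfolded R] qr_factorization_V[OF i]] .
  moreover have "i + 1 \<in> {1..m}" using i by simp
  ultimately show "R (i + 1) = V (i + 1) * Bt (i + 1) \<and> U (i + 1) = V (i + 1) \<and> B (i + 1) = Bt (i + 1) \<and>
      M (i + 1) = Mt (i + 1)" using R step(3) diagonal_block[of "i + 1"] by simp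
qed

end

section \<open>The Lanczos recurrence in floating point arithmetic\<close>

text \<open>Two arithmetics, since the absence of overflow and underflow is known only in the QR
  factorizations, where \<open>rdq\<close> is used.\<close>

locale fl_lanczos_input = lanczos_input m p \<rho> s Mt Bt + rd: exact_arithmetic F rd + rdq: exact_arithmetic F rdq
  for m p \<rho> s Mt Bt F rd rdq +
  assumes Mt_mem: "i \<in> {1..m} \<Longrightarrow> elements_mat (Mt i) \<subseteq> F"
    and Bt_mem: "i \<in> {2..m} \<Longrightarrow> elements_mat (Bt i) \<subseteq> F"
    and one_mem: "1 \<in> F"
    and square_mem: "b \<in> F \<Longrightarrow> rdq (b * b) y \<Longrightarrow> y \<in> F"
    and sqrt_square: "b \<in> F \<Longrightarrow> 0 < b \<Longrightarrow> rdq (b * b) y \<Longrightarrow> rdq (sqrt y) z \<Longrightarrow> z = b"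
begin

lemma T_mem: "elements_mat T \<subseteq> F"
proof
  fix x assume "x \<in> elements_mat T"
  then obtain d e where de: "d < n" "e < n" and x: "x = T $$ (d, e)"
    unfolding elements_mat_eq by (auto simp: carrier_matD[OF T_carrier])
  define i where "i = e div p + 1"
  have d: "d div p < m" "d mod p < p" and e: "e div p < m" "e mod p < p"
    using div_mod_block[OF de(1)] div_mod_block[OF de(2)] by simp_all
  have i: "i \<in> {1..m}" using e by (simp add: i_def)
  have "x = T $$ (d, (i - 1) * p + e mod p)"
    by (simp add: x i_def)
  note x = this[unfolded T_index[OF i de(1) e(2)]]
  have M: "Mt i $$ (d mod p, e mod p) \<in> F"
    using Mt_mem[OF i] elements_matI[OF Mt(1)[OF i] d(2) e(2) refl] by blast
  have low: "Bt (i + 1) $$ (d mod p, e mod p) \<in> F" if "d div p = i"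
  proof -
    have i1: "i + 1 \<in> {2..m}" using that d i by simp
    show ?thesis using Bt_mem[OF i1] elements_matI[OF Bt(1)[OF i1] d(2) e(2) refl] by blast
  qed
  have up: "transpose_mat (Bt i) $$ (d mod p, e mod p) \<in> F" if "d div p + 2 = i"
  proof -
    have i2: "i \<in> {2..m}" using that i by simp
    have "transpose_mat (Bt i) $$ (d mod p, e mod p) = Bt i $$ (e mod p, d mod p)"
      using Bt(1)[OF i2] d e by simp
    then show ?thesis using Bt_mem[OF i2] elements_matI[OF Bt(1)[OF i2] e(2) d(2) refl] by auto
  qed
  show "x \<in> F" unfolding x using M low up rd.zero_mem by (simp split: if_split)
qed

lemma A_mem: "elements_mat A \<subseteq> F"
proof -
  have "elements_mat (P.X * T) \<subseteq> F"
    by (rule rd.signed_unit_rows_mult_mem[OF P.signed_unit_rows T_mem]) (simp add: carrier_matD[OF T_carrier])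
  then show ?thesis unfolding A_def
    by (rule rd.signed_unit_cols_mult_mem[rotated]) (simp_all add: P.signed_unit_rows carrier_matD[OF T_carrier])
qed

lemma B0_mem: "i \<in> {1..m} \<Longrightarrow> elements_mat (B0 i) \<subseteq> F"
  using Bt_mem[of i] elements_0_mat[of p p] rd.zero_mem unfolding B0_def by (cases "i = 1") auto

lemma signed_unit_V:
  assumes "i \<le> m"
  shows "signed_unit_rows (V i)" "signed_unit_rows (transpose_mat (V i))"
  unfolding V_def using selection.signed_unit_rows[OF selection_V[OF assms]]
    selection.signed_unit_rows_transpose[OF selection_V[OF assms]] by blast+

lemma fl_diagonal_block:
  assumes i: "i \<in> {1..m}" and M: "fl_mult3 rd (transpose_mat (V i)) A (V i) M"
  shows "M = Mt i"
proof -
  have "i \<le> m" using i by simp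
  then show ?thesis
    using rd.fl_mult3_signed_unit_cols[OF M signed_unit_V(2) A_mem A_carrier V_carrier n_pos]
      diagonal_block[OF i] by simp
qed

text \<open>By the disjointness of the terms, the summands of each entry are \<open>x, -x, 0\<close> or \<open>x, 0, 0\<close> up to
  order.\<close>

lemma fl_recurrence:
  assumes i: "i \<in> {1..<m}"
    and X: "fl_mult rd A (V i) X" and Y: "fl_mult rd (V i) (Mt i) Y"
    and Z: "fl_mult rd (V (i - 1)) (transpose_mat (B0 i)) Z"
    and R: "R \<in> carrier_mat n p"
      "\<And>r c. r < n \<Longrightarrow> c < p \<Longrightarrow> fl_sum rd {# X $$ (r, c), - Y $$ (r, c), - Z $$ (r, c) #} (R $$ (r, c))"
  shows "R = V (i + 1) * Bt (i + 1)"
proof -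
  have i': "i \<in> {1..m}" "i + 1 \<in> {2..m}" "i \<le> m" "i - 1 \<le> m" using i by auto
  have X: "X = A * V i"
    using rd.fl_mult_signed_unit_cols[OF X signed_unit_V(2)[OF i'(3)] A_mem]
      carrier_matD[OF A_carrier] carrier_matD[OF V_carrier[of i]] n_pos by simp
  have Y: "Y = V i * Mt i"
    using rd.fl_mult_signed_unit_rows[OF Y signed_unit_V(1)[OF i'(3)] Mt_mem[OF i'(1)]]
      carrier_matD[OF Mt(1)[OF i'(1)]] carrier_matD[OF V_carrier[of i]] p_pos by simp
  have Z: "Z = V (i - 1) * transpose_mat (B0 i)"
    using rd.fl_mult_signed_unit_rows[OF Z signed_unit_V(1)[OF i'(4)]] B0_mem[OF i'(1)]
      carrier_matD[OF B0_carrier[OF i'(1)]] carrier_matD[OF V_carrier[of "i - 1"]] p_pos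
    by (simp add: elements_mat_transpose)
  have X_mem: "X $$ (r, c) \<in> F" if "r < n" "c < p" for r c
    using rd.signed_unit_cols_mult_mem[OF signed_unit_V(2)[OF i'(3)] A_mem]
      elements_matI[OF mult_carrier_mat[OF A_carrier V_carrier[of i]] that refl]
      carrier_matD[OF A_carrier] carrier_matD[OF V_carrier[of i]] unfolding X by auto
  have entry: "R $$ (\<rho> d, c) = (V (i + 1) * Bt (i + 1)) $$ (\<rho> d, c)" if d: "d < n" and c: "c < p" for d c
  proof -
    note terms = recurrence_terms[OF i d c, folded X Y Z]
    let ?x = "X $$ (\<rho> d, c)" and ?y = "Y $$ (\<rho> d, c)" and ?z = "Z $$ (\<rho> d, c)"
    have "filter_mset (\<lambda>x. x \<noteq> 0) {# ?x, - ?y, - ?z #} \<subseteq># {# ?x, - ?x #}"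
      unfolding terms(1,2) by auto
    from rd.fl_sum_cancelling[OF R(2)[OF P.less[OF d] c] this X_mem[OF P.less[OF d] c]]
    have "R $$ (\<rho> d, c) = ?x - ?y - ?z" by simp
    also have "\<dots> = (V (i + 1) * Bt (i + 1)) $$ (\<rho> d, c)"
      unfolding terms(1-3) using terms(4) by simp
    finally show ?thesis .
  qed
  have car: "V (i + 1) * Bt (i + 1) \<in> carrier_mat n p"
    using mult_carrier_mat[OF V_carrier Bt(1)[OF i'(2)]] .
  show ?thesis
  proof (rule eq_matI)
    fix r c assume "r < dim_row (V (i + 1) * Bt (i + 1))" "c < dim_col (V (i + 1) * Bt (i + 1))"
    then have rc: "r < n" "c < p" unfolding carrier_matD[OF car] by simp_all
    obtain d where d: "d < n" "r = \<rho> d" using row_cases[OF rc(1)] .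
    show "R $$ (r, c) = (V (i + 1) * Bt (i + 1)) $$ (r, c)" unfolding d(2) using entry[OF d(1) rc(2)] .
  qed (simp_all only: carrier_matD[OF car] carrier_matD[OF R(1)])
qed

lemma fl_qr:
  assumes i: "i \<in> {1..<m}" and qr: "gs_qr rdq var (V (i + 1) * Bt (i + 1)) Q S"
  shows "Q = V (i + 1)" "S = Bt (i + 1)"
proof -
  have i': "i + 1 \<in> {2..m}" "i + 1 \<le> m" using i by auto
  interpret V: selection n p "\<lambda>k. \<rho> ((i + 1 - 1) * p + k)" "\<lambda>k. s ((i + 1 - 1) * p + k)"
    by (rule selection_V[OF i'(2)])
  interpret gram_schmidt_input F rdq n p "\<lambda>k. \<rho> ((i + 1 - 1) * p + k)" "\<lambda>k. s ((i + 1 - 1) * p + k)"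
    "Bt (i + 1)" "V (i + 1) * Bt (i + 1)"
  proof unfold_locales
    show "V (i + 1) * Bt (i + 1) = V.X * Bt (i + 1)" by (simp only: V_def)
  qed (fact Bt(1)[OF i'(1)] Bt_mem[OF i'(1)] Bt(2)[OF i'(1)] Bt(3)[OF i'(1)] one_mem square_mem sqrt_square)+
  show "Q = V (i + 1)" using gs_qr_exact(1)[OF qr] by (simp only: V_def)
  show "S = Bt (i + 1)" using gs_qr_exact(2)[OF qr] .
qed

theorem fl_block_lanczos_expected_run:
  assumes run: "fl_block_lanczos rd rdq var p m A (V 1) U R M B"
  shows "expected_run U R M B"
proof (rule expected_runI)
  note run = run[unfolded fl_block_lanczos_def]
  show U: "U 0 = V 1" "U 1 = V 1" "B 1 = 0\<^sub>m p p" using run by blast+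
  have one: "1 \<in> {1..m}" using m_pos by simp
  have "fl_mult3 rd (transpose_mat (U 1)) A (U 1) (M 1)" using run by blast
  then show "M 1 = Mt 1" unfolding U(2) by (rule fl_diagonal_block[OF one])
  fix i assume i: "i \<in> {1..<m}" and IH: "U i = V i" "U (i - 1) = V (i - 1)" "M i = Mt i" "B i = B0 i"
  note step = run[THEN conjunct2, THEN conjunct2, THEN conjunct2, THEN conjunct2, THEN bspec, OF i,
      unfolded IH]
  from step obtain X Y Z where XYZ: "fl_mult rd A (V i) X" "fl_mult rd (V i) (Mt i) Y"
      "fl_mult rd (V (i - 1)) (transpose_mat (B0 i)) Z"
    and R: "R (i + 1) \<in> carrier_mat (dim_row A) p"
      "\<forall>r < dim_row A. \<forall>c < p.
        fl_sum rd {# X $$ (r, c), - Y $$ (r, c), - Z $$ (r, c) #} (R (i + 1) $$ (r, c))"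
    by blast
  have dim: "dim_row A = n" using A_carrier by simp
  have Req: "R (i + 1) = V (i + 1) * Bt (i + 1)"
    by (rule fl_recurrence[OF i XYZ]) (use R in \<open>simp_all add: dim\<close>)
  have qr: "gs_qr rdq var (R (i + 1)) (U (i + 1)) (B (i + 1))" using step by blast
  note UB = fl_qr[OF i qr[unfolded Req]]
  have i1: "i + 1 \<in> {1..m}" using i by simp
  have "fl_mult3 rd (transpose_mat (U (i + 1))) A (U (i + 1)) (M (i + 1))" using step by blast
  then have "M (i + 1) = Mt (i + 1)" unfolding UB(1) by (rule fl_diagonal_block[OF i1])
  then show "R (i + 1) = V (i + 1) * Bt (i + 1) \<and> U (i + 1) = V (i + 1) \<and> B (i + 1) = Bt (i + 1) \<and>
      M (i + 1) = Mt (i + 1)" using Req UB by simp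
qed

end

lemma block_tridiagonal_cong:
  assumes M: "\<And>i. i \<in> {1..k} \<Longrightarrow> M i = M' i" and B: "\<And>i. i \<in> {2..k} \<Longrightarrow> B i = B' i"
  shows "block_tridiagonal p k M B = block_tridiagonal p k M' B'"
proof (rule eq_matI)
  fix r c assume "r < dim_row (block_tridiagonal p k M' B')" "c < dim_col (block_tridiagonal p k M' B')"
  then have rc: "r < k * p" "c < k * p" by (simp_all add: block_tridiagonal_def)
  have "M (Suc (r div p)) = M' (Suc (r div p))" using M div_mod_block[OF rc(1)] by simp
  moreover have "B (Suc (r div p)) = B' (Suc (r div p))" if "r div p = Suc (c div p)"
    using B div_mod_block[OF rc(1)] that by simp
  moreover have "B (Suc (c div p)) = B' (Suc (c div p))" if "c div p = Suc (r div p)"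
    using B div_mod_block[OF rc(2)] that by simp
  ultimately show "block_tridiagonal p k M B $$ (r, c) = block_tridiagonal p k M' B' $$ (r, c)"
    using rc by (cases "r div p = c div p") (simp_all add: block_tridiagonal_def Let_def)
qed (simp_all add: block_tridiagonal_def)

theorem theorem6p4:
  fixes t :: nat and emax :: int and fl :: "real \<Rightarrow> real"
    and n m p :: nat and var :: gs_variant
    and P T A U\<^sub>1 :: "real mat"
    and Mt Bt :: "nat \<Rightarrow> real mat"
    and U R M B :: "nat \<Rightarrow> real mat"
  assumes "ieee_format t emax" and "rounds_to_nearest t emax fl"
    and "0 < m" and "0 < p" and "n = m * p"
    and "P \<in> carrier_mat n n" and "elements_mat P \<subseteq> floats t emax"
    and "signed_block_permutation_mat m p P"
    and "\<And>i. i \<in> {1..m} \<Longrightarrow> Mt i \<in> carrier_mat p p \<and> elements_mat (Mt i) \<subseteq> floats t emax \<and>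
           transpose_mat (Mt i) = Mt i"
    and "\<And>i. i \<in> {2..m} \<Longrightarrow> Bt i \<in> carrier_mat p p \<and> elements_mat (Bt i) \<subseteq> floats t emax \<and>
           upper_triangular (Bt i) \<and> (\<forall>k < p. 0 < Bt i $$ (k, k))"
    and "T = block_tridiagonal p m Mt Bt"
    and "A = P * T * transpose_mat P"
    and "U\<^sub>1 = P * first_block_column m p"
    and "fl_block_lanczos (fl_op fl) (fl_op_in_range t emax fl) var p m A U\<^sub>1 U R M B"
  shows "(\<exists>U' R' M' B'. block_lanczos p m A U\<^sub>1 U' R' M' B') \<and>
    (\<forall>U' R' M' B'. block_lanczos p m A U\<^sub>1 U' R' M' B' \<longrightarrow>
       (\<forall>i \<in> {0..m}. U i = U' i) \<and> (\<forall>i \<in> {2..m}. R i = R' i) \<and>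
       (\<forall>i \<in> {1..m}. M i = M' i) \<and> (\<forall>i \<in> {1..m}. B i = B' i)) \<and>
    block_tridiagonal p m M B = T"
proof -
  have fmt: "1 \<le> emax" using assms(1) by (simp add: ieee_format_def)
  note rn = assms(2)
  obtain \<rho> s where sel: "selection (m * p) (m * p) \<rho> s"
    and P: "P = signed_selection (m * p) (m * p) \<rho> s"
    using signed_block_permutation_selection[OF assms(8)] .
  interpret P: selection "m * p" "m * p" \<rho> s by (rule sel)
  interpret fl_lanczos_input m p \<rho> s Mt Bt "floats t emax" "fl_op fl" "fl_op_in_range t emax fl"
  proof unfold_locales
    show "z = x" if "fl_op fl x z" "x \<in> floats t emax" for x z
      using that fl_of_float[OF rn] by (simp add: fl_op_def)
    show "z = x" if "fl_op_in_range t emax fl x z" "x \<in> floats t emax" for x z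
      using that fl_of_float[OF rn] by (simp add: fl_op_in_range_def)
    show "y \<in> floats t emax" if "fl_op_in_range t emax fl (b * b) y" for b y
      using that rn by (simp add: fl_op_in_range_def rounds_to_nearest_def)
    show "z = b" if "b \<in> floats t emax" "0 < b" "fl_op_in_range t emax fl (b * b) y"
      "fl_op_in_range t emax fl (sqrt y) z" for b y z
      using that fl_sqrt_of_fl_square[OF assms(1) rn that(1,2)] by (simp add: fl_op_in_range_def)
    show "0 \<in> floats t emax" by (rule zero_in_floats[OF fmt])
    show "- x \<in> floats t emax" if "x \<in> floats t emax" for x by (rule uminus_in_floats[OF that])
    show "1 \<in> floats t emax" by (rule one_in_floats[OF assms(1)])
    show "0 < m" "0 < p" by (fact assms(3), fact assms(4))
  qed (use assms(9,10) in blast)+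
  have A: "A = local.A" using assms(11,12) by (simp add: P A_def)
  have U1: "U\<^sub>1 = V 1" unfolding assms(13) P by (rule V_1[symmetric])
  have computed: "expected_run U R M B"
    using fl_block_lanczos_expected_run assms(14) unfolding A U1 .
  have "(\<forall>i \<in> {0..m}. U i = U' i) \<and> (\<forall>i \<in> {2..m}. R i = R' i) \<and>
       (\<forall>i \<in> {1..m}. M i = M' i) \<and> (\<forall>i \<in> {1..m}. B i = B' i)"
    if "block_lanczos p m A U\<^sub>1 U' R' M' B'" for U' R' M' B'
    using computed block_lanczos_unique[OF that[unfolded A U1]] unfolding expected_run_def by simp
  moreover have "\<exists>U' R' M' B'. block_lanczos p m A U\<^sub>1 U' R' M' B'"
    using block_lanczos_run unfolding A U1 by blast
  moreover have "block_tridiagonal p m M B = T"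
    unfolding assms(11) using computed
    by (intro block_tridiagonal_cong) (simp_all add: expected_run_def B0_def)
  ultimately show ?thesis by blast
qed

end
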